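(* Assume the setting and notation described in the context, and assume moreover that $N=2$, $t=e-1\geq 2$, $e\mid (q^{m/2}-1)$ and $2\mid a$. Then $\mathcal{C}_{(a_1,\ldots,a_t)}$ is an $[n,tm]$ cyclic code over $\mathbb{F}_q$ with minimal Hamming distance $d=\frac{2(q-1)(r-\sqrt{r})}{(t+1)q\delta}$, and it has at most $\frac{1}{2}(t^2+5t-2)$ distinct nonzero weights. Its weight distribution is as follows. The weight $0$ occurs once. For integers $1\le k\le t$ and $0\le u\le k+1$ put $$F_{k,u}=\frac{r-1}{r\,2^{k+2}}\binom{t+1}{k+1}\binom{k+1}{u}\Big\{2(r-1)^k-(-1)^k\big[(1+\sqrt r)^u(1-\sqrt r)^{k+1-u}+(1-\sqrt r)^u(1+\sqrt r)^{k+1-u}\big]\Big\}.$$ (i) If $q\equiv 1\pmod 4$, put $W_{k,u}=\frac{q-1}{(t+1)q\delta}\{(k+1)r-(k+1-2u)\sqrt r\}$. (ii) If $q\equiv 3\pmod 4$, put $W_{k,u}=\frac{q-1}{(t+1)q\delta}\{(k+1)r-(-1)^{m/2}(k+1-2u)\sqrt r\}$. In either case, for every $w>0$ the number of codewords of Hamming weight $w$ equals $\sum F_{k,u}$, the sum running over all pairs $(k,u)$ with $1\le k\le t$, $0\le u\le k+1$ and $W_{k,u}=w$.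
   Context: Let $p$ be a prime, $s,m\ge 1$ integers, $q=p^s$, $r=q^m$, and let $\gamma$ be a generator of $\mathbb{F}_r^*$. Let $e\ge t\ge 2$ be integers with $e\mid(r-1)$, let $a$ be an integer with $a\not\equiv 0\pmod{r-1}$, and let $\Delta_1,\ldots,\Delta_t$ be integers, pairwise incongruent modulo $e$, with $\gcd(\Delta_2-\Delta_1,\ldots,\Delta_t-\Delta_1,e)=1$. Let $a_i\equiv a+\frac{r-1}{e}\Delta_i\pmod{r-1}$ for $1\le i\le t$. Assume that the minimal polynomials $h_{a_i}(x)$ of $\gamma^{-a_i}$ over $\mathbb{F}_q$ all have degree $m$ and are pairwise distinct. Put $N=\gcd\!\left(\frac{r-1}{q-1},ae\right)$, $\delta=\gcd(r-1,a_1,\ldots,a_t)$ and $n=\frac{r-1}{\delta}$. The code is $$\mathcal{C}_{(a_1,\ldots,a_t)}=\left\{\left(\mathrm{Tr}_{r/q}\Big(\sum_{j=1}^t x_j\gamma^{a_j i}\Big)\right)_{i=0}^{n-1} : x_1,\ldots,x_t\in\mathbb{F}_r\right\},$$ where $\mathrm{Tr}_{r/q}$ is the trace map from $\mathbb{F}_r$ to $\mathbb{F}_q$. The codewords are counted as the $r^t$ tuples $(x_1,\dots,x_t)$ (the code has dimension $tm$, so this is a bijection). *)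

theory Defs
  imports
    Complex_Main
    "HOL-Library.Cardinality"
    "HOL-Library.FuncSet"
    "HOL-Library.Function_Algebras"
    "HOL-Computational_Algebra.Polynomial"
    "HOL-Number_Theory.Cong"
begin

text \<open>
  An extension of fields is given by an embedding \<open>\<iota>\<close> of the type \<open>'q\<close> of the small field
  into the type \<open>'r\<close> of the large one.
\<close>

definition field_embedding :: "('q::field \<Rightarrow> 'r::field) \<Rightarrow> bool" where
  "field_embedding \<iota> \<longleftrightarrow>
     \<iota> 1 = 1 \<and> (\<forall>x y. \<iota> (x + y) = \<iota> x + \<iota> y) \<and> (\<forall>x y. \<iota> (x * y) = \<iota> x * \<iota> y)"

definition generates_units :: "'r::field \<Rightarrow> bool" where
  "generates_units \<gamma> \<longleftrightarrow> range (\<lambda>i::int. \<gamma> powi i) = UNIV - {0}"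

text \<open>
  The trace of an extension of degree \<open>m\<close>; its value is pulled back along \<open>\<iota>\<close>, so that it
  really lies in the small field.
\<close>

definition field_trace :: "('q::{field,finite} \<Rightarrow> 'r::field) \<Rightarrow> nat \<Rightarrow> 'r \<Rightarrow> 'q" where
  "field_trace \<iota> m x = (THE y. \<iota> y = (\<Sum>i<m. x ^ (CARD('q) ^ i)))"

definition minimal_poly :: "('q::field \<Rightarrow> 'r::field) \<Rightarrow> 'r \<Rightarrow> 'q poly" where
  "minimal_poly \<iota> x =
     (THE f. lead_coeff f = 1 \<and> poly (map_poly \<iota> f) x = 0 \<and>
        (\<forall>g. g \<noteq> 0 \<and> poly (map_poly \<iota> g) x = 0 \<longrightarrow> degree f \<le> degree g))"

text \<open>
  A word of length \<open>n\<close> is a function on \<open>nat\<close> that vanishes outside \<open>{..<n}\<close>.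
\<close>

definition scale_word :: "'q::field \<Rightarrow> (nat \<Rightarrow> 'q) \<Rightarrow> nat \<Rightarrow> 'q" where
  "scale_word c v = (\<lambda>i. c * v i)"

global_interpretation word_space: vector_space "scale_word :: 'q::field \<Rightarrow> (nat \<Rightarrow> 'q) \<Rightarrow> nat \<Rightarrow> 'q"
  by unfold_locales (auto simp: scale_word_def fun_eq_iff algebra_simps)

definition words :: "nat \<Rightarrow> (nat \<Rightarrow> 'q::field) set" where
  "words n = {v. \<forall>i\<ge>n. v i = 0}"

definition linear_code :: "nat \<Rightarrow> nat \<Rightarrow> (nat \<Rightarrow> 'q::field) set \<Rightarrow> bool" where
  "linear_code n k C \<longleftrightarrow> C \<subseteq> words n \<and> word_space.subspace C \<and> word_space.dim C = k"

definition cyclic_shift :: "nat \<Rightarrow> (nat \<Rightarrow> 'q::field) \<Rightarrow> nat \<Rightarrow> 'q" where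
  "cyclic_shift n v = (\<lambda>i. if i < n then v ((i + n - 1) mod n) else 0)"

definition cyclic_code :: "nat \<Rightarrow> nat \<Rightarrow> (nat \<Rightarrow> 'q::field) set \<Rightarrow> bool" where
  "cyclic_code n k C \<longleftrightarrow> linear_code n k C \<and> (\<forall>c\<in>C. cyclic_shift n c \<in> C)"

definition hamming_weight :: "nat \<Rightarrow> (nat \<Rightarrow> 'q::field) \<Rightarrow> nat" where
  "hamming_weight n v = card {i. i < n \<and> v i \<noteq> 0}"

definition hamming_dist :: "nat \<Rightarrow> (nat \<Rightarrow> 'q::field) \<Rightarrow> (nat \<Rightarrow> 'q) \<Rightarrow> nat" where
  "hamming_dist n v w = card {i. i < n \<and> v i \<noteq> w i}"

definition min_distance :: "nat \<Rightarrow> (nat \<Rightarrow> 'q::field) set \<Rightarrow> nat" where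
  "min_distance n C = Inf {hamming_dist n v w | v w. v \<in> C \<and> w \<in> C \<and> v \<noteq> w}"

definition tuples :: "nat \<Rightarrow> (nat \<Rightarrow> 'r) set" where
  "tuples t = {1..t} \<rightarrow>\<^sub>E UNIV"

definition codeword ::
  "('q::{field,finite} \<Rightarrow> 'r::field) \<Rightarrow> nat \<Rightarrow> 'r \<Rightarrow> nat \<Rightarrow> nat \<Rightarrow> (nat \<Rightarrow> int) \<Rightarrow> (nat \<Rightarrow> 'r) \<Rightarrow> nat \<Rightarrow> 'q"
where
  "codeword \<iota> m \<gamma> n t as x =
     (\<lambda>i. if i < n then field_trace \<iota> m (\<Sum>j=1..t. x j * \<gamma> powi (as j * int i)) else 0)"

definition trace_code ::
  "('q::{field,finite} \<Rightarrow> 'r::field) \<Rightarrow> nat \<Rightarrow> 'r \<Rightarrow> nat \<Rightarrow> nat \<Rightarrow> (nat \<Rightarrow> int) \<Rightarrow> (nat \<Rightarrow> 'q) set"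
where
  "trace_code \<iota> m \<gamma> n t as = codeword \<iota> m \<gamma> n t as ` tuples t"

definition freq :: "nat \<Rightarrow> nat \<Rightarrow> nat \<Rightarrow> nat \<Rightarrow> real" where
  "freq r t k u =
     (real r - 1) / (real r * 2 ^ (k + 2)) * real ((t + 1) choose (k + 1)) * real ((k + 1) choose u) *
     (2 * (real r - 1) ^ k
      - (-1) ^ k * ((1 + sqrt (real r)) ^ u * (1 - sqrt (real r)) ^ (k + 1 - u)
                    + (1 - sqrt (real r)) ^ u * (1 + sqrt (real r)) ^ (k + 1 - u)))"

text \<open>The two cases are \<open>q mod 4 = 1\<close> and \<open>q mod 4 = 3\<close>.\<close>

definition weight1 :: "nat \<Rightarrow> nat \<Rightarrow> nat \<Rightarrow> nat \<Rightarrow> nat \<Rightarrow> nat \<Rightarrow> real" where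
  "weight1 q r t \<delta> k u =
     (real q - 1) / ((real t + 1) * real q * real \<delta>) *
     ((real k + 1) * real r - (real k + 1 - 2 * real u) * sqrt (real r))"

definition weight3 :: "nat \<Rightarrow> nat \<Rightarrow> nat \<Rightarrow> nat \<Rightarrow> nat \<Rightarrow> nat \<Rightarrow> nat \<Rightarrow> real" where
  "weight3 q m r t \<delta> k u =
     (real q - 1) / ((real t + 1) * real q * real \<delta>) *
     ((real k + 1) * real r - (-1) ^ (m div 2) * (real k + 1 - 2 * real u) * sqrt (real r))"

end

theory Submission
  imports Defs "HOL-Number_Theory.Residues"
begin

text \<open>
  Let \<open>\<eta>\<close> be the quadratic character of the large field and \<open>\<beta> = \<gamma> powi ((r - 1) div e)\<close>. The entry
  of a codeword at position \<open>i\<close> is the trace of \<open>\<gamma> powi (a * i) * y i\<close>, where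
  \<open>y h = (\<Sum>j. x j * \<beta> powi (\<Delta> j * h))\<close> only depends on \<open>h\<close> modulo \<open>e\<close>. As \<open>N = 2\<close>, averaging
  over the positions in one residue class modulo \<open>e\<close> amounts to averaging over the nonzero
  squares, so the weight is a sum over \<open>h\<close> of terms depending only on \<open>\<eta> (y h)\<close>, and these terms are
  found from the sum of \<open>\<eta>\<close> over the kernel of the trace. The square of that sum follows from the
  correlation \<open>\<Sum>z. \<eta> z * \<eta> (d - z)\<close>; its sign is irrelevant, because the frequencies are invariant
  under \<open>u \<mapsto> k + 1 - u\<close>. Since \<open>t = e - 1\<close> frequencies are used out of \<open>e\<close>, after multiplication
  with squares the vectors \<open>y\<close> run through the hyperplane of zero-sum vectors, in which the vectors
  with prescribed quadratic characters are counted by induction on the number of coordinates.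
\<close>

section \<open>Sums of periodic functions\<close>

definition periodic :: "int \<Rightarrow> (int \<Rightarrow> 'a) \<Rightarrow> bool" where
  "periodic M F \<longleftrightarrow> (\<forall>i j. [i = j] (mod M) \<longrightarrow> F i = F j)"

lemma periodicD: "periodic M F \<Longrightarrow> [i = j] (mod M) \<Longrightarrow> F i = F j"
  by (simp add: periodic_def)

lemma sum_periodic_reindex:
  fixes F :: "int \<Rightarrow> 'a::comm_monoid_add"
  assumes "M > 0" "periodic M F" and inj: "inj_on (\<lambda>i. g i mod M) {0..<M}"
  shows "(\<Sum>i\<in>{0..<M}. F (g i)) = (\<Sum>i\<in>{0..<M}. F i)"
proof -
  have "(\<lambda>i. g i mod M) ` {0..<M} = {0..<M}"
    by (rule endo_inj_surj) (use \<open>M > 0\<close> inj in auto)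
  then have "(\<Sum>i\<in>{0..<M}. F i) = (\<Sum>i\<in>{0..<M}. F (g i mod M))"
    using sum.reindex[OF inj, of F] by simp
  also have "\<dots> = (\<Sum>i\<in>{0..<M}. F (g i))"
    by (intro sum.cong refl periodicD[OF \<open>periodic M F\<close>]) simp
  finally show ?thesis ..
qed

lemma sum_periodic_shift:
  fixes F :: "int \<Rightarrow> 'a::comm_monoid_add"
  assumes "M > 0" "periodic M F"
  shows "(\<Sum>i\<in>{0..<M}. F (i + d)) = (\<Sum>i\<in>{0..<M}. F i)"
proof (rule sum_periodic_reindex[OF assms], rule inj_onI)
  fix i j assume "i \<in> {0..<M}" "j \<in> {0..<M}" "(i + d) mod M = (j + d) mod M"
  then have "[i = j] (mod M)" unfolding cong_def[symmetric] cong_add_rcancel by simp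
  then show "i = j" using \<open>i \<in> _\<close> \<open>j \<in> _\<close> by (auto intro: cong_less_imp_eq_int)
qed

lemma sum_periodic_scale:
  fixes F :: "int \<Rightarrow> 'a::comm_monoid_add"
  assumes "M > 0" "periodic M F" "coprime b M"
  shows "(\<Sum>i\<in>{0..<M}. F (b * i)) = (\<Sum>i\<in>{0..<M}. F i)"
proof (rule sum_periodic_reindex[OF assms(1,2)], rule inj_onI)
  fix i j assume "i \<in> {0..<M}" "j \<in> {0..<M}" "(b * i) mod M = (b * j) mod M"
  then have "[i = j] (mod M)"
    unfolding cong_def[symmetric] cong_mult_lcancel[OF \<open>coprime b M\<close>] by simp
  then show "i = j" using \<open>i \<in> _\<close> \<open>j \<in> _\<close> by (auto intro: cong_less_imp_eq_int)
qed

lemma sum_int_residue_classes: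
  fixes F :: "int \<Rightarrow> 'a::comm_monoid_add"
  assumes "M > 0"
  shows "(\<Sum>i\<in>{0..<M * L}. F i) = (\<Sum>h\<in>{0..<M}. \<Sum>l\<in>{0..<L}. F (h + M * l))"
proof -
  have "(\<Sum>(h, l)\<in>{0..<M} \<times> {0..<L}. F (h + M * l)) = (\<Sum>i\<in>{0..<M * L}. F i)"
  proof (rule sum.reindex_bij_witness[of _ "\<lambda>i. (i mod M, i div M)" "\<lambda>(h, l). h + M * l"])
    fix hl assume "hl \<in> {0..<M} \<times> {0..<L}"
    then obtain h l where hl: "hl = (h, l)" "0 \<le> h" "h < M" "0 \<le> l" "l + 1 \<le> L" by auto
    then have "h + M * l < M * (l + 1)" by (simp add: algebra_simps)
    also have "\<dots> \<le> M * L" using hl \<open>M > 0\<close> by (intro mult_left_mono) auto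
    finally show "(case hl of (h, l) \<Rightarrow> h + M * l) \<in> {0..<M * L}" using hl \<open>M > 0\<close> by simp
    show "((case hl of (h, l) \<Rightarrow> h + M * l) mod M, (case hl of (h, l) \<Rightarrow> h + M * l) div M) = hl"
      using hl by simp
  next
    fix i assume "i \<in> {0..<M * L}"
    moreover have "M * (i div M) \<le> i"
      using \<open>M > 0\<close> mult_div_mod_eq[of M i] pos_mod_sign[of M i] by linarith
    ultimately have "M * (i div M) < M * L" by simp
    with \<open>i \<in> _\<close> show "(i mod M, i div M) \<in> {0..<M} \<times> {0..<L}"
      using \<open>M > 0\<close> by (simp add: pos_imp_zdiv_nonneg_iff)
  qed (auto split: prod.split)
  then show ?thesis by (simp add: sum.cartesian_product)
qed

lemma sum_periodic_multiple:
  fixes F :: "int \<Rightarrow> 'a::comm_semiring_1"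
  assumes "M > 0" "periodic M F"
  shows "(\<Sum>i\<in>{0..<M * int k}. F i) = of_nat k * (\<Sum>i\<in>{0..<M}. F i)"
proof -
  have "F (h + M * l) = F h" for h l
    by (rule periodicD[OF assms(2)]) (simp add: cong_iff_dvd_diff)
  then show ?thesis
    using \<open>M > 0\<close> by (simp add: sum_int_residue_classes sum_distrib_left)
qed

lemma sum_periodic_scale_gcd:
  fixes F :: "int \<Rightarrow> 'a::comm_semiring_1"
  assumes "M > 0" "periodic M F"
  shows "(\<Sum>i\<in>{0..<M}. F (b * i)) = (\<Sum>i\<in>{0..<M}. F (gcd b M * i))"
proof -
  define g where "g = gcd b M"
  have "g > 0" using \<open>M > 0\<close> by (simp add: g_def)
  then obtain b' M' where b: "b = b' * g" and M: "M = M' * g" and "coprime b' M'"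
    unfolding g_def using gcd_coprime_exists[of b M] by auto
  have "M' > 0" using \<open>M > 0\<close> \<open>g > 0\<close> by (simp add: M zero_less_mult_iff)
  have per: "periodic M' (\<lambda>i. F (g * c * i))" for c
    unfolding periodic_def
  proof (intro allI impI)
    fix i j assume "[i = j] (mod M')"
    then have "M dvd g * (c * (i - j))" by (simp add: M cong_iff_dvd_diff)
    then show "F (g * c * i) = F (g * c * j)"
      by (intro periodicD[OF assms(2)]) (simp add: cong_iff_dvd_diff algebra_simps)
  qed
  have "(\<Sum>i\<in>{0..<M}. F (b * i)) = of_nat (nat g) * (\<Sum>i\<in>{0..<M'}. F (g * b' * i))"
    using sum_periodic_multiple[OF \<open>M' > 0\<close> per[of b'], of "nat g"] \<open>g > 0\<close>
    by (simp add: b M mult.commute)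
  also have "(\<Sum>i\<in>{0..<M'}. F (g * b' * i)) = (\<Sum>i\<in>{0..<M'}. F (g * i))"
    using sum_periodic_scale[OF \<open>M' > 0\<close> per[of 1] \<open>coprime b' M'\<close>] by (simp add: mult.assoc)
  also have "of_nat (nat g) * \<dots> = (\<Sum>i\<in>{0..<M}. F (g * i))"
    using sum_periodic_multiple[OF \<open>M' > 0\<close> per[of 1], of "nat g"] \<open>g > 0\<close>
    by (simp add: M mult.commute)
  finally show ?thesis by (simp only: g_def)
qed

section \<open>Finite fields and the quadratic character\<close>

lemma card_finite_field_gt_1: "CARD('a::{field,finite}) > 1"
  using card_mono[of UNIV "{0, 1::'a}"] by simp

lemma power_card_minus_1_finite_field:
  fixes x :: "'a::{field,finite}"
  assumes "x \<noteq> 0"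
  shows "x ^ (CARD('a) - 1) = 1"
proof -
  have "(\<Prod>y\<in>UNIV-{0}. x * y) = (\<Prod>y\<in>UNIV-{0::'a}. y)"
    by (rule prod.reindex_bij_witness[of _ "\<lambda>y. y / x" "\<lambda>y. x * y"]) (use assms in auto)
  moreover have "(\<Prod>y\<in>UNIV-{0::'a}. y) \<noteq> 0" by simp
  ultimately show ?thesis by (simp add: prod.distrib card_Diff_singleton)
qed

lemma power_card_finite_field:
  fixes x :: "'a::{field,finite}"
  shows "x ^ CARD('a) = x"
proof (cases "x = 0")
  case False
  then show ?thesis
    using power_card_minus_1_finite_field[of x] power_minus_mult[of "CARD('a)" x] by simp
qed simp

lemma sum_const_on_units:
  fixes f :: "'a::{field,finite} \<Rightarrow> real"
  assumes "\<And>c. c \<noteq> 0 \<Longrightarrow> f c = f 1"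
  shows "(\<Sum>c\<in>UNIV. f c) = f 0 + (real CARD('a) - 1) * f 1"
proof -
  have "(\<Sum>c\<in>UNIV. f c) = f 0 + (\<Sum>c\<in>UNIV-{0}. f c)"
    using sum.remove[of UNIV 0 f] by simp
  also have "(\<Sum>c\<in>UNIV-{0}. f c) = (\<Sum>c\<in>UNIV-{0::'a}. f 1)"
    by (intro sum.cong refl assms) auto
  also have "\<dots> = (real CARD('a) - 1) * f 1"
    using card_finite_field_gt_1[where 'a='a] by (simp add: card_Diff_singleton of_nat_diff)
  finally show ?thesis .
qed

lemma of_nat_neq_0_finite_field:
  assumes "e dvd CARD('a) - 1"
  shows "of_nat e \<noteq> (0::'a::{field,finite})"
proof
  assume "of_nat e = (0::'a)"
  obtain c where "CARD('a) - 1 = e * c" using assms by (rule dvdE)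
  then have "CARD('a) = e * c + 1" using card_finite_field_gt_1[where 'a='a] by simp
  then have "(of_nat CARD('a) :: 'a) = of_nat (e * c + 1)" by (rule arg_cong)
  moreover have "of_nat CARD('a) = (0::'a)"
    using CHAR_dvd_CARD[where 'a='a] by (simp add: of_nat_eq_0_iff_char_dvd)
  ultimately show False using \<open>of_nat e = 0\<close> by simp
qed

lemma CHAR_finite_field_prime_power:
  assumes "prime p" "CARD('a::{field,finite}) = p ^ k"
  shows "CHAR('a) = p"
proof -
  have "prime CHAR('a)"
    by (rule prime_CHAR_semidom) (simp add: finite_imp_CHAR_pos)
  moreover have "CHAR('a) dvd p ^ k"
    using CHAR_dvd_CARD[where 'a='a] assms(2) by simp
  ultimately show ?thesis
    using assms(1) prime_dvd_power primes_dvd_imp_eq by blast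
qed

definition quad_char :: "'a::field \<Rightarrow> real" where
  "quad_char x = (if x = 0 then 0 else if \<exists>y. x = y ^ 2 then 1 else -1)"

lemma quad_char_0 [simp]: "quad_char 0 = 0"
  by (simp add: quad_char_def)

lemma quad_char_eq_0_iff [simp]: "quad_char x = 0 \<longleftrightarrow> x = 0"
  by (simp add: quad_char_def)

lemma quad_char_cases: "x \<noteq> 0 \<Longrightarrow> quad_char x = 1 \<or> quad_char x = -1"
  by (simp add: quad_char_def)

lemma quad_char_eq_1E:
  assumes "quad_char x = 1"
  obtains y where "x = y ^ 2" "y \<noteq> 0"
  using assms by (auto simp: quad_char_def split: if_splits)

lemma quad_char_square_mult:
  assumes "y \<noteq> 0"
  shows "quad_char (y ^ 2 * x) = quad_char x"
proof -
  have "(\<exists>z. y ^ 2 * x = z ^ 2) \<longleftrightarrow> (\<exists>z. x = z ^ 2)"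
  proof
    assume "\<exists>z. y ^ 2 * x = z ^ 2"
    then obtain z where "y ^ 2 * x = z ^ 2" ..
    then have "x = (z / y) ^ 2" using assms by (simp add: power_divide field_simps)
    then show "\<exists>z. x = z ^ 2" ..
  qed (auto simp flip: power_mult_distrib)
  then show ?thesis using assms by (simp add: quad_char_def)
qed

lemma quad_char_square: "y \<noteq> 0 \<Longrightarrow> quad_char (y ^ 2) = 1"
  by (auto simp: quad_char_def)

lemma quad_char_inverse: "quad_char (inverse x) = quad_char x"
proof (cases "x = 0")
  case False
  then have "inverse x = (inverse x) ^ 2 * x" by (simp add: power2_eq_square)
  then show ?thesis using False quad_char_square_mult by (metis nonzero_imp_inverse_nonzero)
qed simp

lemma two_neq_0_finite_field:
  assumes "odd CARD('a)"
  shows "(2::'a::{field,finite}) \<noteq> 0"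
proof -
  have "2 dvd CARD('a) - 1" using assms by simp
  then show ?thesis using of_nat_neq_0_finite_field[of 2, where 'a='a] by simp
qed

lemma sum_over_squares:
  fixes f :: "'a::{field,finite} \<Rightarrow> real"
  assumes "(2::'a) \<noteq> 0"
  shows "(\<Sum>y\<in>UNIV-{0}. f (y ^ 2)) = (\<Sum>s\<in>UNIV-{0}. (1 + quad_char s) * f s)"
proof -
  have fibre: "(\<Sum>y\<in>{y\<in>UNIV-{0}. y ^ 2 = s}. f (y ^ 2)) = (1 + quad_char s) * f s" if "s \<noteq> 0" for s
  proof (cases "quad_char s = 1")
    case True
    then obtain y where y: "s = y ^ 2" "y \<noteq> 0" by (rule quad_char_eq_1E)
    have "y \<noteq> - y" using y assms by (simp add: eq_neg_iff_add_eq_0 flip: mult_2)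
    moreover have "{z\<in>UNIV-{0}. z ^ 2 = s} = {y, - y}"
      using y by (auto simp: power2_eq_iff)
    ultimately show ?thesis using True by (simp add: y(1))
  next
    case False
    then have "{z\<in>UNIV-{0}. z ^ 2 = s} = {}" by (auto simp: quad_char_square)
    then show ?thesis using False quad_char_cases[OF that] by (simp only:) simp
  qed
  have "(\<Sum>y\<in>UNIV-{0}. f (y ^ 2)) = (\<Sum>s\<in>UNIV-{0}. \<Sum>y\<in>{y\<in>UNIV-{0}. y ^ 2 = s}. f (y ^ 2))"
    by (rule sum.group[symmetric]) auto
  also have "\<dots> = (\<Sum>s\<in>UNIV-{0}. (1 + quad_char s) * f s)"
    by (intro sum.cong refl fibre) simp
  finally show ?thesis .
qed

lemma sum_quad_char:
  assumes "(2::'a::{field,finite}) \<noteq> 0"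
  shows "(\<Sum>x\<in>(UNIV::'a set). quad_char x) = 0"
proof -
  have "(\<Sum>x\<in>UNIV-{0::'a}. quad_char x) = 0"
    using sum_over_squares[OF assms, of "\<lambda>_. 1"] by (simp add: sum.distrib)
  then show ?thesis using sum.remove[of UNIV "0::'a" quad_char] by simp
qed

text \<open>No generator is needed: for a nonsquare \<open>x\<close> the terms \<open>quad_char (x * z) + quad_char z\<close> are
  nonpositive and add up to \<open>0\<close>.\<close>
lemma quad_char_mult:
  fixes x y :: "'a::{field,finite}"
  assumes "(2::'a) \<noteq> 0"
  shows "quad_char (x * y) = quad_char x * quad_char y"
proof -
  consider (zero) "x = 0" | (square) "quad_char x = 1" | (nonsquare) "x \<noteq> 0" "quad_char x = -1"
    using quad_char_cases by blast
  then show ?thesis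
  proof cases
    case square
    then show ?thesis by (auto elim!: quad_char_eq_1E simp: quad_char_square_mult quad_char_square)
  next
    case nonsquare_x: nonsquare
    have nonpos: "quad_char (x * z) + quad_char z \<le> 0" for z
    proof -
      consider (zero) "z = 0" | (square) "quad_char z = 1" | (nonsquare) "z \<noteq> 0" "quad_char z = -1"
        using quad_char_cases by blast
      then show ?thesis
      proof cases
        case square
        then obtain w where "z = w ^ 2" "w \<noteq> 0" by (rule quad_char_eq_1E)
        then show ?thesis
          using nonsquare_x quad_char_square_mult[of w x]
          by (simp add: quad_char_square mult.commute)
      next
        case nonsquare
        then show ?thesis using nonsquare_x quad_char_cases[of "x * z"] by auto
      qed simp
    qed
    have "(\<Sum>z\<in>UNIV. quad_char (x * z)) = (\<Sum>z\<in>(UNIV::'a set). quad_char z)"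
      by (rule sum.reindex_bij_witness[of _ "\<lambda>z. z / x" "\<lambda>z. x * z"]) (use nonsquare_x in auto)
    then have "(\<Sum>z\<in>UNIV. - (quad_char (x * z) + quad_char z)) = 0"
      by (simp add: sum_negf sum_subtractf sum_quad_char[OF assms])
    moreover have "- (quad_char (x * z) + quad_char z) \<ge> 0" for z using nonpos[of z] by simp
    ultimately have "- (quad_char (x * y) + quad_char y) = 0"
      by (subst (asm) sum_nonneg_eq_0_iff) (simp_all del: minus_add_distrib)
    then show ?thesis using nonsquare_x by simp
  qed simp
qed

lemma card_power_eq_1_le:
  fixes k :: nat
  assumes "k > 0"
  shows "card {z::'a::idom. z ^ k = 1} \<le> k"
proof -
  define P :: "'a poly" where "P = Polynomial.monom 1 k - 1"
  have "poly.coeff P k = 1" using assms by (simp add: P_def)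
  then have "P \<noteq> 0" by auto
  then have "card {z. poly P z = 0} \<le> degree P" by (rule card_poly_roots_bound)
  also have "degree P \<le> k" unfolding P_def by (intro degree_diff_le degree_monom_le) simp
  also have "{z. poly P z = 0} = {z. z ^ k = 1}" by (simp add: P_def poly_monom)
  finally show ?thesis .
qed

lemma sum_quad_char_convolution:
  fixes d :: "'a::{field,finite}"
  assumes "(2::'a) \<noteq> 0"
  shows "(\<Sum>x\<in>UNIV. quad_char x * quad_char (d - x))
       = quad_char (- 1 :: 'a) * ((if d = 0 then real CARD('a) else 0) - 1)"
proof (cases "d = 0")
  case True
  have "quad_char x * quad_char (d - x) = quad_char (- 1 :: 'a)" if "x \<noteq> 0" for x
    using quad_char_mult[OF assms, of "- 1" x] quad_char_cases[OF that] True by auto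
  then have "(\<Sum>x\<in>UNIV. quad_char x * quad_char (d - x)) = (\<Sum>x\<in>UNIV-{0::'a}. quad_char (- 1 :: 'a))"
    by (intro sum.mono_neutral_cong_right) auto
  then show ?thesis
    using True card_finite_field_gt_1[where 'a='a] by (simp add: card_Diff_singleton of_nat_diff)
next
  case False
  have "quad_char x * quad_char (d - x) = quad_char (d / x - 1)" if "x \<noteq> 0" for x
  proof -
    have "quad_char x * quad_char (d - x) = quad_char (inverse x * (d - x))"
      by (simp add: quad_char_mult[OF assms] quad_char_inverse)
    also have "inverse x * (d - x) = d / x - 1" using that by (simp add: field_simps)
    finally show ?thesis .
  qed
  then have "(\<Sum>x\<in>UNIV. quad_char x * quad_char (d - x)) = (\<Sum>x\<in>UNIV-{0}. quad_char (d / x - 1))"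
    by (intro sum.mono_neutral_cong_right) auto
  also have "\<dots> = (\<Sum>y\<in>UNIV-{- 1 :: 'a}. quad_char y)"
    by (rule sum.reindex_bij_witness[of _ "\<lambda>y. d / (y + 1)" "\<lambda>x. d / x - 1"])
       (use False in \<open>auto simp: field_simps eq_neg_iff_add_eq_0\<close>)
  also have "\<dots> = - quad_char (- 1 :: 'a)"
    by (simp add: sum_diff1 sum_quad_char[OF assms])
  finally show ?thesis using False by simp
qed

lemma sum_quad_char_eq:
  fixes f :: "'a::{field,finite} \<Rightarrow> real"
  assumes "\<tau> = 1 \<or> \<tau> = -1"
  shows "(\<Sum>s | quad_char s = \<tau>. f s)
       = ((\<Sum>s\<in>UNIV. f s) - f 0 + \<tau> * (\<Sum>s\<in>UNIV. quad_char s * f s)) / 2"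
proof -
  have indicator: "(if quad_char s = \<tau> then f s else 0)
      = (f s - (if s = 0 then f 0 else 0) + \<tau> * (quad_char s * f s)) / 2" for s
    using assms quad_char_cases[of s] by (cases "s = 0") auto
  have "(\<Sum>s | quad_char s = \<tau>. f s) = (\<Sum>s\<in>UNIV. if quad_char s = \<tau> then f s else 0)"
    using sum.inter_filter[of UNIV f "\<lambda>s. quad_char s = \<tau>"] by simp
  also have "\<dots> = (\<Sum>s\<in>UNIV. (f s - (if s = 0 then f 0 else 0) + \<tau> * (quad_char s * f s)) / 2)"
    by (intro sum.cong refl indicator)
  finally show ?thesis
    by (simp add: sum.distrib sum_subtractf sum_distrib_left flip: sum_divide_distrib)
qed

lemma card_quad_char_eq:
  assumes "(2::'a::{field,finite}) \<noteq> 0" "\<tau> = 1 \<or> \<tau> = -1"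
  shows "real (card {s::'a. quad_char s = \<tau>}) = (real CARD('a) - 1) / 2"
  using sum_quad_char_eq[OF assms(2), of "\<lambda>_::'a. 1"] by (simp add: sum_quad_char[OF assms(1)])

lemma quad_char_eq_1_iff_power:
  fixes x :: "'a::{field,finite}"
  assumes "odd CARD('a)"
  shows "quad_char x = 1 \<longleftrightarrow> x ^ ((CARD('a) - 1) div 2) = 1"
proof -
  define k where "k = (CARD('a) - 1) div 2"
  have card: "CARD('a) - 1 = 2 * k" using assms by (simp add: k_def)
  then have "k > 0" using card_finite_field_gt_1[where 'a='a] by simp
  have "{s::'a. quad_char s = 1} = {s. s ^ k = 1}"
  proof (rule card_seteq)
    show "{s::'a. quad_char s = 1} \<subseteq> {s. s ^ k = 1}"
      using power_card_minus_1_finite_field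
      by (auto elim!: quad_char_eq_1E simp flip: power_mult card)
    have "card {s::'a. s ^ k = 1} \<le> k"
      by (rule card_power_eq_1_le) fact
    also have "k = card {s::'a. quad_char s = 1}"
      using card_quad_char_eq[OF two_neq_0_finite_field[OF assms], of 1] card by simp
    finally show "card {s::'a. s ^ k = 1} \<le> card {s::'a. quad_char s = 1}" .
  qed simp
  then show ?thesis unfolding k_def by blast
qed

section \<open>Sums of elements with prescribed quadratic characters\<close>

text \<open>For \<open>\<theta> = \<plusminus>1\<close> this is a sum of nontrivial additive characters over one class of nonzero
  elements modulo squares; its values are recorded in closed form, so that no additive character is
  needed.\<close>
definition quad_eigenfun :: "real \<Rightarrow> 'a::{field,finite} \<Rightarrow> real" where
  "quad_eigenfun \<theta> c = (if c = 0 then real CARD('a) / 2 else 0) - 1 / 2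
     + \<theta> * sqrt (real CARD('a)) / 2 * quad_char c"

definition quad_eigenval :: "real \<Rightarrow> real \<Rightarrow> real" where
  "quad_eigenval R \<tau> = (if \<tau> = 0 then 1 else (- 1 + \<tau> * sqrt R) / 2)"

lemma sum_quad_eigenfun:
  fixes c :: "'a::{field,finite}"
  assumes "(2::'a) \<noteq> 0"
  shows "(\<Sum>s\<in>UNIV. quad_eigenfun \<theta> (c - s)) = 0"
proof -
  have "(\<Sum>s\<in>UNIV. quad_eigenfun \<theta> (c - s)) = (\<Sum>s\<in>UNIV. quad_eigenfun \<theta> (s::'a))"
    by (rule sum.reindex_bij_witness[of _ "\<lambda>s. c - s" "\<lambda>s. c - s"]) auto
  also have "\<dots> = 0"
    unfolding quad_eigenfun_def sum.distrib sum_subtractf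
      sum_distrib_left[symmetric] sum_quad_char[OF assms]
    by simp
  finally show ?thesis .
qed

lemma sum_quad_char_quad_eigenfun:
  fixes c :: "'a::{field,finite}"
  assumes "(2::'a) \<noteq> 0" "quad_char (- 1 :: 'a) = 1" "\<theta> = 1 \<or> \<theta> = -1"
  shows "(\<Sum>s\<in>UNIV. quad_char s * quad_eigenfun \<theta> (c - s))
       = \<theta> * sqrt (real CARD('a)) * quad_eigenfun \<theta> c"
proof -
  let ?R = "real CARD('a)"
  have "(\<Sum>s\<in>UNIV. quad_char s * quad_eigenfun \<theta> (c - s))
      = (\<Sum>s\<in>UNIV. (if s = c then ?R / 2 * quad_char c else 0) - 1 / 2 * quad_char s
          + \<theta> * sqrt ?R / 2 * (quad_char s * quad_char (c - s)))"
    by (intro sum.cong) (auto simp: quad_eigenfun_def algebra_simps)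
  also have "\<dots> = ?R / 2 * quad_char c + \<theta> * sqrt ?R / 2 * ((if c = 0 then ?R else 0) - 1)"
    by (simp add: sum.distrib sum_subtractf sum_quad_char[OF assms(1)] assms(2)
        sum_quad_char_convolution[OF assms(1)] flip: sum_distrib_left sum_divide_distrib)
  also have "?R = (\<theta> * sqrt ?R) * (\<theta> * sqrt ?R)" using assms(3) by auto
  finally show ?thesis using assms(3) by (auto simp: quad_eigenfun_def algebra_simps)
qed

lemma sum_quad_class_quad_eigenfun:
  fixes c :: "'a::{field,finite}"
  assumes "(2::'a) \<noteq> 0" "quad_char (- 1 :: 'a) = 1"
    and "\<tau> \<in> {-1, 0, 1}" and \<theta>: "\<theta> = 1 \<or> \<theta> = -1"
  shows "(\<Sum>s | quad_char s = \<tau>. quad_eigenfun \<theta> (c - s))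
       = quad_eigenval (real CARD('a)) (\<theta> * \<tau>) * quad_eigenfun \<theta> c"
proof (cases "\<tau> = 0")
  case False
  then have \<tau>: "\<tau> = 1 \<or> \<tau> = -1" using assms(3) by auto
  show ?thesis
    unfolding sum_quad_char_eq[OF \<tau>] sum_quad_eigenfun[OF assms(1)]
      sum_quad_char_quad_eigenfun[OF assms(1,2) \<theta>]
    using \<tau> \<theta> by (auto simp: quad_eigenval_def field_simps)
qed (simp add: quad_eigenval_def)

lemma card_PiE_insert_sum:
  fixes T :: "'i \<Rightarrow> 'a::{ab_group_add,finite} set"
  assumes "finite J" "h \<notin> J"
  shows "card {z \<in> PiE (insert h J) T. sum z (insert h J) = c}
       = (\<Sum>s\<in>T h. card {z \<in> PiE J T. sum z J = c - s})"
proof -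
  let ?S = "SIGMA s:T h. {z \<in> PiE J T. sum z J = c - s}" and ?upd = "\<lambda>(s, z). z(h := s)"
  have sum_upd: "sum (z(h := s)) (insert h J) = s + sum z J" for z :: "'i \<Rightarrow> 'a" and s
  proof -
    have "sum (z(h := s)) J = sum z J" using assms(2) by (intro sum.cong) auto
    then show ?thesis using assms by (subst sum.insert) simp_all
  qed
  have "{z \<in> PiE (insert h J) T. sum z (insert h J) = c}
      = ?upd ` {x \<in> T h \<times> PiE J T. sum (?upd x) (insert h J) = c}"
    unfolding PiE_insert_eq by blast
  also have "{x \<in> T h \<times> PiE J T. sum (?upd x) (insert h J) = c} = ?S"
    by (auto simp: sum_upd algebra_simps simp del: fun_upd_apply)
  finally have "{z \<in> PiE (insert h J) T. sum z (insert h J) = c} = ?upd ` ?S" .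
  moreover have "inj_on ?upd ?S"
    by (rule inj_on_subset[OF inj_combinator[OF assms(2), of T]]) auto
  ultimately show ?thesis
    using assms by (simp add: card_image card_SigmaI finite_PiE)
qed

text \<open>Convolution with the indicator function of a class multiplies the constant \<open>1\<close> by the size of
  the class and \<open>quad_eigenfun \<theta>\<close> by an eigenvalue, and the indicator function of \<open>0\<close> is
  \<open>(1 + quad_eigenfun 1 + quad_eigenfun (- 1)) / CARD('a)\<close>.\<close>
lemma card_PiE_quad_class_sum:
  fixes c :: "'a::{field,finite}"
  assumes two: "(2::'a) \<noteq> 0" and minus_1: "quad_char (- 1 :: 'a) = 1"
    and "finite J" "\<And>h. h \<in> J \<Longrightarrow> \<tau> h \<in> {-1, 0, 1}"
  shows "real (card {z \<in> PiE J (\<lambda>h. {s. quad_char s = \<tau> h}). sum z J = c})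
     = ((\<Prod>h\<in>J. if \<tau> h = 0 then 1 else (real CARD('a) - 1) / 2)
        + (\<Prod>h\<in>J. quad_eigenval (real CARD('a)) (\<tau> h)) * quad_eigenfun 1 c
        + (\<Prod>h\<in>J. quad_eigenval (real CARD('a)) (- \<tau> h)) * quad_eigenfun (- 1) c) / real CARD('a)"
  using assms(3,4)
proof (induction J arbitrary: c rule: finite_induct)
  case empty
  have "{z. z = (\<lambda>x. undefined) \<and> c = 0} = (if c = 0 then {\<lambda>x. undefined} else {})" by auto
  then show ?case by (simp add: quad_eigenfun_def)
next
  case (insert h J)
  let ?R = "real CARD('a)" and ?T = "\<lambda>h. {s::'a. quad_char s = \<tau> h}"
  let ?A = "\<Prod>h\<in>J. if \<tau> h = 0 then 1 else (?R - 1) / 2"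
    and ?P = "\<Prod>h\<in>J. quad_eigenval ?R (\<tau> h)" and ?N = "\<Prod>h\<in>J. quad_eigenval ?R (- \<tau> h)"
  have \<tau>: "\<tau> h \<in> {-1, 0, 1}" using insert.prems by simp
  have card_T: "real (card (?T h)) = (if \<tau> h = 0 then 1 else (?R - 1) / 2)"
    using \<tau> card_quad_char_eq[OF two, of "\<tau> h"] by auto
  have "real (card {z \<in> PiE (insert h J) ?T. sum z (insert h J) = c})
      = (\<Sum>s\<in>?T h. real (card {z \<in> PiE J ?T. sum z J = c - s}))"
    using insert.hyps by (subst card_PiE_insert_sum) simp_all
  also have "\<dots> = (\<Sum>s\<in>?T h.
      (?A + ?P * quad_eigenfun 1 (c - s) + ?N * quad_eigenfun (- 1) (c - s)) / ?R)"
    using insert.prems by (intro sum.cong refl insert.IH) auto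
  also have "\<dots> = (real (card (?T h)) * ?A + ?P * (quad_eigenval ?R (\<tau> h) * quad_eigenfun 1 c)
      + ?N * (quad_eigenval ?R (- \<tau> h) * quad_eigenfun (- 1) c)) / ?R"
    using sum_quad_class_quad_eigenfun[OF two minus_1 \<tau>, of 1 c]
      sum_quad_class_quad_eigenfun[OF two minus_1 \<tau>, of "- 1" c]
    by (simp add: sum.distrib flip: sum_divide_distrib sum_distrib_left)
  finally show ?case using insert.hyps by (simp add: card_T mult_ac)
qed

section \<open>Zero-sum vectors and their weights\<close>

definition zero_sums :: "'i set \<Rightarrow> ('i \<Rightarrow> 'a::comm_monoid_add) set" where
  "zero_sums I = {z \<in> PiE I (\<lambda>_. UNIV). sum z I = 0}"

definition quad_type :: "real \<Rightarrow> 'i set \<Rightarrow> ('i \<Rightarrow> 'a::field) \<Rightarrow> nat \<times> nat" where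
  "quad_type \<epsilon> I z = (card {h \<in> I. z h \<noteq> 0}, card {h \<in> I. \<epsilon> * quad_char (z h) = 1})"

definition quad_weight :: "real \<Rightarrow> 'a::{field,finite} \<Rightarrow> real" where
  "quad_weight \<epsilon> z = (if z = 0 then 0 else real CARD('a)) + \<epsilon> * quad_char z * sqrt (real CARD('a))"

lemma card_zero_sums:
  assumes "finite I" "I \<noteq> {}"
  shows "card (zero_sums I :: ('i \<Rightarrow> 'a::{ab_group_add,finite}) set) = CARD('a) ^ (card I - 1)"
proof -
  obtain h where "h \<in> I" using assms(2) by blast
  define J where "J = I - {h}"
  have I: "I = insert h J" "h \<notin> J" "finite J" using \<open>h \<in> I\<close> assms(1) by (auto simp: J_def)
  have "card (zero_sums I :: ('i \<Rightarrow> 'a) set)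
      = (\<Sum>s\<in>UNIV. card {z \<in> PiE J (\<lambda>_. UNIV :: 'a set). sum z J = - s})"
    unfolding zero_sums_def I(1) using I(2,3) by (subst card_PiE_insert_sum) simp_all
  also have "\<dots> = (\<Sum>s\<in>UNIV. card {z \<in> PiE J (\<lambda>_. UNIV :: 'a set). sum z J = s})"
    by (rule sum.reindex_bij_witness[of _ uminus uminus]) auto
  also have "\<dots> = (\<Sum>s\<in>UNIV. \<Sum>z\<in>{z \<in> PiE J (\<lambda>_. UNIV :: 'a set). sum z J = s}. 1)" by simp
  also have "\<dots> = card (PiE J (\<lambda>_. UNIV :: 'a set))"
    using I(3) by (subst sum.group) (simp_all add: finite_PiE)
  finally show ?thesis using I by (simp add: card_PiE)
qed

lemma quad_weight_0 [simp]: "quad_weight \<epsilon> 0 = 0"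
  by (simp add: quad_weight_def)

lemma quad_weight_square_mult: "y \<noteq> 0 \<Longrightarrow> quad_weight \<epsilon> (y ^ 2 * z) = quad_weight \<epsilon> z"
  by (simp add: quad_weight_def quad_char_square_mult)

lemma quad_weight_powi_even_mult:
  assumes "x \<noteq> 0" "even i"
  shows "quad_weight \<epsilon> (x powi i * z) = quad_weight \<epsilon> z"
proof -
  obtain j where "i = j * 2" using assms(2) by (metis dvdE mult.commute)
  then have "x powi i = (x powi j) ^ 2" by (simp only: power_int_mult power_int_numeral)
  then show ?thesis using assms(1) quad_weight_square_mult[of "x powi j"] by simp
qed

lemma sqrt_less_self: "(x::real) > 1 \<Longrightarrow> sqrt x < x"
  using mult_strict_left_mono[of 1 "sqrt x" "sqrt x"] by simp

lemma quad_weight_pos: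
  fixes z :: "'a::{field,finite}"
  assumes "\<epsilon> = 1 \<or> \<epsilon> = -1" "z \<noteq> 0"
  shows "quad_weight \<epsilon> z > 0"
proof -
  have "sqrt (real CARD('a)) < real CARD('a)"
    using card_finite_field_gt_1[where 'a='a] by (intro sqrt_less_self) simp
  moreover have "\<epsilon> * quad_char z = 1 \<or> \<epsilon> * quad_char z = -1"
    using quad_char_cases[OF assms(2)] assms(1) by auto
  ultimately show ?thesis
    using assms(2) by (auto simp: quad_weight_def intro: add_pos_nonneg)
qed

lemma sum_quad_weight_eq_0_iff:
  fixes z :: "'i \<Rightarrow> 'a::{field,finite}"
  assumes "finite I" "\<epsilon> = 1 \<or> \<epsilon> = -1"
  shows "(\<Sum>h\<in>I. quad_weight \<epsilon> (z h)) = 0 \<longleftrightarrow> (\<forall>h\<in>I. z h = 0)"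
proof -
  have nonneg: "quad_weight \<epsilon> x \<ge> 0" for x :: 'a
    using quad_weight_pos[OF assms(2), of x] by (cases "x = 0") auto
  have "quad_weight \<epsilon> x = 0 \<longleftrightarrow> x = 0" for x :: 'a
    using quad_weight_pos[OF assms(2), of x] by (cases "x = 0") auto
  then show ?thesis using assms(1) nonneg by (simp add: sum_nonneg_eq_0_iff)
qed

lemma sum_quad_weight:
  fixes z :: "'i \<Rightarrow> 'a::{field,finite}"
  assumes "finite I" and \<epsilon>: "\<epsilon> = 1 \<or> \<epsilon> = -1" and type: "quad_type \<epsilon> I z = (N, u)"
  shows "(\<Sum>h\<in>I. quad_weight \<epsilon> (z h))
       = real N * real CARD('a) - (real N - 2 * real u) * sqrt (real CARD('a))"
proof -
  let ?R = "real CARD('a)"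
  have "quad_weight \<epsilon> x = of_bool (x \<noteq> 0) * (?R - sqrt ?R)
      + of_bool (\<epsilon> * quad_char x = 1) * (2 * sqrt ?R)" for x :: 'a
    using \<epsilon> quad_char_cases[of x] by (cases "x = 0") (auto simp: quad_weight_def)
  then have "(\<Sum>h\<in>I. quad_weight \<epsilon> (z h)) = (\<Sum>h\<in>I. of_bool (z h \<noteq> 0)) * (?R - sqrt ?R)
      + (\<Sum>h\<in>I. of_bool (\<epsilon> * quad_char (z h) = 1)) * (2 * sqrt ?R)"
    by (simp only: sum.distrib sum_distrib_right)
  also have "(\<Sum>h\<in>I. of_bool (z h \<noteq> 0)) = real N"
    using type assms(1) by (simp add: quad_type_def sum_of_bool_eq Int_def)
  also have "(\<Sum>h\<in>I. of_bool (\<epsilon> * quad_char (z h) = 1)) = real u"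
    using type assms(1) by (simp add: quad_type_def sum_of_bool_eq Int_def)
  finally show ?thesis by (simp add: algebra_simps)
qed

definition zero_sum_count :: "real \<Rightarrow> nat \<Rightarrow> nat \<Rightarrow> real" where
  "zero_sum_count R N u = (((R - 1) / 2) ^ N + (R - 1) / 2 *
     (quad_eigenval R 1 ^ u * quad_eigenval R (- 1) ^ (N - u)
      + quad_eigenval R (- 1) ^ u * quad_eigenval R 1 ^ (N - u))) / R"

definition sign_pattern :: "real \<Rightarrow> 'i set \<Rightarrow> 'i set \<Rightarrow> 'i \<Rightarrow> real" where
  "sign_pattern \<epsilon> A J h = (if h \<in> A then \<epsilon> else if h \<in> J then - \<epsilon> else 0)"

lemma prod_sign_pattern:
  fixes f :: "real \<Rightarrow> 'b::comm_monoid_mult"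
  assumes "finite I" "A \<subseteq> J" "J \<subseteq> I" "f 0 = 1"
  shows "(\<Prod>h\<in>I. f (sign_pattern \<epsilon> A J h)) = f \<epsilon> ^ card A * f (- \<epsilon>) ^ (card J - card A)"
proof -
  have "finite A" using assms(1-3) by (meson finite_subset)
  have "(\<Prod>h\<in>I. f (sign_pattern \<epsilon> A J h))
      = (\<Prod>h\<in>I. if h \<in> A then f \<epsilon> else if h \<in> J then f (- \<epsilon>) else 1)"
    using assms(4) by (intro prod.cong) (auto simp: sign_pattern_def)
  moreover have "I \<inter> A = A" "I \<inter> - A \<inter> J = J - A" using assms by auto
  ultimately show ?thesis
    using assms \<open>finite A\<close> by (simp add: prod.If_cases card_Diff_subset)
qed

lemma zero_sums_sign_pattern_eq:
  fixes A J I :: "'i set"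
  assumes "A \<subseteq> J" "J \<subseteq> I" and \<epsilon>: "\<epsilon> = 1 \<or> \<epsilon> = -1"
  shows "{z \<in> zero_sums I. {h \<in> I. z h \<noteq> 0} = J \<and> {h \<in> I. \<epsilon> * quad_char (z h) = 1} = A}
      = {z \<in> PiE I (\<lambda>h. {s::'a::field. quad_char s = sign_pattern \<epsilon> A J h}). sum z I = 0}"
proof -
  have class_iff: "quad_char x = sign_pattern \<epsilon> A J h
      \<longleftrightarrow> (x \<noteq> 0 \<longleftrightarrow> h \<in> J) \<and> (\<epsilon> * quad_char x = 1 \<longleftrightarrow> h \<in> A)" for x :: 'a and h
    using \<epsilon> quad_char_cases[of x] \<open>A \<subseteq> J\<close> by (cases "x = 0") (auto simp: sign_pattern_def)
  have Collect_eq: "{h \<in> I. P h} = B \<longleftrightarrow> (\<forall>h\<in>I. P h \<longleftrightarrow> h \<in> B)" if "B \<subseteq> I" for P B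
    using that by blast
  show ?thesis
    using assms(1,2) by (auto simp: zero_sums_def PiE_iff class_iff Collect_eq)
qed

lemma card_zero_sums_of_quad_classes:
  fixes A J I :: "'i set"
  assumes "(2::'a::{field,finite}) \<noteq> 0" "quad_char (- 1 :: 'a) = 1"
    and "finite I" "A \<subseteq> J" "J \<subseteq> I" and \<epsilon>: "\<epsilon> = 1 \<or> \<epsilon> = -1"
  shows "real (card {z \<in> zero_sums I :: ('i \<Rightarrow> 'a) set.
      {h \<in> I. z h \<noteq> 0} = J \<and> {h \<in> I. \<epsilon> * quad_char (z h) = 1} = A})
    = zero_sum_count (real CARD('a)) (card J) (card A)"
proof -
  let ?R = "real CARD('a)" and ?\<tau> = "sign_pattern \<epsilon> A J"
  have \<tau>: "?\<tau> h \<in> {-1, 0, 1}" for h using \<epsilon> by (auto simp: sign_pattern_def)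
  note prods = prod_sign_pattern[OF assms(3-5), of _ \<epsilon>]
  have sizes: "(\<Prod>h\<in>I. if ?\<tau> h = 0 then 1 else (?R - 1) / 2) = ((?R - 1) / 2) ^ card J"
  proof -
    have "card A \<le> card J" using assms(3-5) by (meson card_mono finite_subset)
    then show ?thesis
      using prods[of "\<lambda>x. if x = 0 then 1 else (?R - 1) / 2"] \<epsilon> by (auto simp flip: power_add)
  qed
  have eigenfun_0: "quad_eigenfun \<theta> (0::'a) = (?R - 1) / 2" for \<theta>
    by (simp add: quad_eigenfun_def diff_divide_distrib)
  have "real (card {z \<in> PiE I (\<lambda>h. {s::'a. quad_char s = ?\<tau> h}). sum z I = 0})
      = (((?R - 1) / 2) ^ card J + (?R - 1) / 2 *
        (quad_eigenval ?R \<epsilon> ^ card A * quad_eigenval ?R (- \<epsilon>) ^ (card J - card A)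
         + quad_eigenval ?R (- \<epsilon>) ^ card A * quad_eigenval ?R \<epsilon> ^ (card J - card A))) / ?R"
    unfolding card_PiE_quad_class_sum[OF assms(1-3) \<tau>] sizes eigenfun_0
    using prods[of "quad_eigenval ?R"] prods[of "\<lambda>x. quad_eigenval ?R (- x)"]
    by (simp add: quad_eigenval_def[of _ 0] algebra_simps)
  then show ?thesis
    unfolding zero_sums_sign_pattern_eq[OF assms(4-6)] using \<epsilon>
    by (auto simp: zero_sum_count_def add.commute)
qed

lemma card_zero_sums_quad_type:
  assumes "(2::'a::{field,finite}) \<noteq> 0" "quad_char (- 1 :: 'a) = 1"
    and "finite I" "\<epsilon> = 1 \<or> \<epsilon> = -1"
  shows "real (card {z \<in> zero_sums I :: ('i \<Rightarrow> 'a) set. quad_type \<epsilon> I z = (N, u)})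
    = real (card I choose N) * real (N choose u) * zero_sum_count (real CARD('a)) N u"
proof -
  let ?Z = "zero_sums I :: ('i \<Rightarrow> 'a) set"
  let ?pattern = "\<lambda>z::'i \<Rightarrow> 'a. ({h \<in> I. z h \<noteq> 0}, {h \<in> I. \<epsilon> * quad_char (z h) = 1})"
  let ?S = "{z \<in> ?Z. quad_type \<epsilon> I z = (N, u)}"
  let ?P = "SIGMA J:{J. J \<subseteq> I \<and> card J = N}. {A. A \<subseteq> J \<and> card A = u}"
  have fin: "finite {A. A \<subseteq> J \<and> card A = u}" if "J \<subseteq> I" for J
    using finite_subset[OF that \<open>finite I\<close>] by simp
  have "finite ?S" using \<open>finite I\<close> by (simp add: zero_sums_def finite_PiE)
  moreover have "finite ?P" using fin \<open>finite I\<close> by (intro finite_SigmaI) auto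
  moreover have "?pattern ` ?S \<subseteq> ?P" by (auto simp: quad_type_def)
  ultimately have "(\<Sum>P\<in>?P. \<Sum>z\<in>{z \<in> ?S. ?pattern z = P}. 1) = (\<Sum>z\<in>?S. 1 :: real)"
    by (rule sum.group)
  then have "real (card ?S) = (\<Sum>P\<in>?P. real (card {z \<in> ?S. ?pattern z = P}))" by simp
  also have "\<dots> = (\<Sum>P\<in>?P. zero_sum_count (real CARD('a)) N u)"
  proof (intro sum.cong refl)
    fix P assume "P \<in> ?P"
    then obtain J A where P: "P = (J, A)" "J \<subseteq> I" "A \<subseteq> J" "card J = N" "card A = u" by auto
    then have "{z \<in> ?S. ?pattern z = P}
        = {z \<in> ?Z. {h \<in> I. z h \<noteq> 0} = J \<and> {h \<in> I. \<epsilon> * quad_char (z h) = 1} = A}"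
      by (auto simp: quad_type_def)
    then show "real (card {z \<in> ?S. ?pattern z = P}) = zero_sum_count (real CARD('a)) N u"
      using card_zero_sums_of_quad_classes[OF assms(1-3) P(3,2) assms(4)] P(4,5) by simp
  qed
  also have "\<dots> = real (card ?P) * zero_sum_count (real CARD('a)) N u" by simp
  also have "card ?P = (\<Sum>J | J \<subseteq> I \<and> card J = N. card {A. A \<subseteq> J \<and> card A = u})"
    using fin \<open>finite I\<close> by (intro card_SigmaI) auto
  also have "\<dots> = (\<Sum>J | J \<subseteq> I \<and> card J = N. N choose u)"
    using \<open>finite I\<close> by (intro sum.cong refl) (auto simp: n_subsets finite_subset)
  also have "\<dots> = (card I choose N) * (N choose u)"
    using \<open>finite I\<close> by (simp add: n_subsets)
  finally show ?thesis by simp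
qed

lemma freq_eq_zero_sum_count:
  assumes "u \<le> k + 1" "r > 0"
  shows "freq r t k u
    = real ((t + 1) choose (k + 1)) * real ((k + 1) choose u) * zero_sum_count (real r) (k + 1) u"
proof -
  let ?s = "sqrt (real r)"
  have signs: "quad_eigenval (real r) \<theta> ^ u * quad_eigenval (real r) (- \<theta>) ^ (k + 1 - u)
      = (- 1) ^ (k + 1) * ((1 - \<theta> * ?s) ^ u * (1 + \<theta> * ?s) ^ (k + 1 - u)) / 2 ^ (k + 1)"
    if "\<theta> = 1 \<or> \<theta> = - 1" for \<theta>
  proof -
    obtain v where v: "k + 1 = u + v" using assms(1) le_Suc_ex by blast
    have eigenval: "quad_eigenval (real r) \<theta> = (- 1) * ((1 - \<theta> * ?s) / 2)"
      "quad_eigenval (real r) (- \<theta>) = (- 1) * ((1 + \<theta> * ?s) / 2)"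
      using that by (auto simp: quad_eigenval_def field_simps)
    show ?thesis
      unfolding eigenval power_mult_distrib power_divide v add_diff_cancel_left' power_add by simp
  qed
  have "zero_sum_count (real r) (k + 1) u = (((real r - 1) / 2) ^ (k + 1) + (real r - 1) / 2 *
      ((- 1) ^ (k + 1) * ((1 - ?s) ^ u * (1 + ?s) ^ (k + 1 - u)) / 2 ^ (k + 1)
     + (- 1) ^ (k + 1) * ((1 + ?s) ^ u * (1 - ?s) ^ (k + 1 - u)) / 2 ^ (k + 1))) / real r"
    unfolding zero_sum_count_def using signs[of 1] signs[of "-1"] by (simp only: minus_minus) simp
  also have "\<dots> = (real r - 1) / (real r * 2 ^ (k + 2)) * (2 * (real r - 1) ^ k
      - (-1) ^ k * ((1 + ?s) ^ u * (1 - ?s) ^ (k + 1 - u) + (1 - ?s) ^ u * (1 + ?s) ^ (k + 1 - u)))"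
    using assms(2) by (simp add: power_divide field_simps)
  finally show ?thesis unfolding freq_def by (simp only: mult_ac)
qed

corollary card_zero_sums_quad_type_freq:
  assumes "(2::'a::{field,finite}) \<noteq> 0" "quad_char (- 1 :: 'a) = 1"
    and "finite I" "card I = t + 1" "\<epsilon> = 1 \<or> \<epsilon> = -1" "u \<le> k + 1"
  shows "real (card {z \<in> zero_sums I :: ('i \<Rightarrow> 'a) set. quad_type \<epsilon> I z = (k + 1, u)})
    = freq CARD('a) t k u"
  unfolding card_zero_sums_quad_type[OF assms(1-3,5)]
    freq_eq_zero_sum_count[OF assms(6) zero_less_card_finite]
  by (simp only: assms(4))

lemma card_support_zero_sums_neq_1:
  assumes "finite I" "z \<in> zero_sums I"
  shows "card {h \<in> I. z h \<noteq> 0} \<noteq> 1"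
proof
  assume "card {h \<in> I. z h \<noteq> 0} = 1"
  then obtain h where h: "{h \<in> I. z h \<noteq> 0} = {h}" by (rule card_1_singletonE)
  have "sum z I = sum z {h \<in> I. z h \<noteq> 0}" using assms(1) by (intro sum.mono_neutral_right) auto
  also have "\<dots> = z h" unfolding h by simp
  also have "\<dots> \<noteq> 0" using h by blast
  finally show False using assms(2) by (simp add: zero_sums_def)
qed

lemma weight_distribution_zero_sums:
  assumes two: "(2::'a::{field,finite}) \<noteq> 0" and minus_1: "quad_char (- 1 :: 'a) = 1"
    and "finite I" "card I = t + 1" and \<epsilon>: "\<epsilon> = 1 \<or> \<epsilon> = -1" and "w > 0"
  shows "real (card {z \<in> zero_sums I :: ('i \<Rightarrow> 'a) set. c * (\<Sum>h\<in>I. quad_weight \<epsilon> (z h)) = w})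
    = (\<Sum>(k, u) | 1 \<le> k \<and> k \<le> t \<and> u \<le> k + 1 \<and>
        c * ((real k + 1) * real CARD('a) - (real k + 1 - 2 * real u) * sqrt (real CARD('a))) = w.
        freq CARD('a) t k u)"
proof -
  let ?Z = "zero_sums I :: ('i \<Rightarrow> 'a) set"
  let ?class = "\<lambda>(k, u). {z \<in> ?Z. quad_type \<epsilon> I z = (k + 1, u)}"
  define W where "W k u =
      c * ((real k + 1) * real CARD('a) - (real k + 1 - 2 * real u) * sqrt (real CARD('a)))"
    for k u
  let ?P = "{(k, u). 1 \<le> k \<and> k \<le> t \<and> u \<le> k + 1 \<and> W k u = w}"
  have weight: "c * (\<Sum>h\<in>I. quad_weight \<epsilon> (z h)) = W k u" if "quad_type \<epsilon> I z = (k + 1, u)"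
    for z :: "'i \<Rightarrow> 'a" and k u
    unfolding sum_quad_weight[OF \<open>finite I\<close> \<epsilon> that] W_def by (simp add: add.commute)
  have type: "\<exists>(k, u)\<in>?P. quad_type \<epsilon> I z = (k + 1, u)"
    if z: "z \<in> ?Z" and w: "c * (\<Sum>h\<in>I. quad_weight \<epsilon> (z h)) = w" for z
  proof -
    obtain N u where Nu: "quad_type \<epsilon> I z = (N, u)" by (cases "quad_type \<epsilon> I z")
    have "\<not> (\<forall>h\<in>I. z h = 0)" using w \<open>w > 0\<close> sum_quad_weight_eq_0_iff[OF \<open>finite I\<close> \<epsilon>, of z] by auto
    then have "N \<noteq> 0" using Nu \<open>finite I\<close> by (auto simp: quad_type_def card_gt_0_iff)
    moreover have "N \<noteq> 1"
      using card_support_zero_sums_neq_1[OF \<open>finite I\<close> z] Nu by (simp add: quad_type_def)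
    moreover have "N \<le> t + 1"
      using Nu card_mono[OF \<open>finite I\<close>, of "{h \<in> I. z h \<noteq> 0}"] \<open>card I = t + 1\<close>
      by (auto simp: quad_type_def)
    moreover have "u \<le> N"
      using Nu \<open>finite I\<close> by (auto simp: quad_type_def intro!: card_mono)
    ultimately show ?thesis
      using Nu w weight[of z "N - 1" u] by (intro bexI[of _ "(N - 1, u)"]) auto
  qed
  have "{z \<in> ?Z. c * (\<Sum>h\<in>I. quad_weight \<epsilon> (z h)) = w} = (\<Union>ku\<in>?P. ?class ku)"
    using type weight by fastforce
  moreover have "finite ?P" by (rule finite_subset[of _ "{..t} \<times> {..t + 1}"]) auto
  moreover have "finite ?Z" using \<open>finite I\<close> by (simp add: zero_sums_def finite_PiE)
  ultimately have classes: "card {z \<in> ?Z. c * (\<Sum>h\<in>I. quad_weight \<epsilon> (z h)) = w}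
      = (\<Sum>ku\<in>?P. card (?class ku))"
    by (simp only:) (rule card_UN_disjoint, auto)
  have "(\<Sum>ku\<in>?P. real (card (?class ku))) = (\<Sum>(k, u)\<in>?P. freq CARD('a) t k u)"
    using card_zero_sums_quad_type_freq[OF two minus_1 \<open>finite I\<close> \<open>card I = t + 1\<close> \<epsilon>]
    by (intro sum.cong) auto
  then show ?thesis unfolding W_def[symmetric] classes of_nat_sum .
qed

section \<open>Generators and roots of unity\<close>

definition primitive_root_of_unity :: "nat \<Rightarrow> 'a::field \<Rightarrow> bool" where
  "primitive_root_of_unity e \<beta> \<longleftrightarrow> e > 0 \<and> (\<forall>i. \<beta> powi i = 1 \<longleftrightarrow> int e dvd i)"

lemma primitive_root_of_unity_neq_0:
  assumes "primitive_root_of_unity e \<beta>"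
  shows "\<beta> \<noteq> 0"
proof
  assume "\<beta> = 0"
  moreover have "\<beta> powi int e = 1" "e > 0"
    using assms unfolding primitive_root_of_unity_def by (blast intro: dvd_refl)+
  ultimately show False by (simp add: power_0_left)
qed

lemma powi_eq_iff_cong:
  assumes "primitive_root_of_unity e \<beta>"
  shows "\<beta> powi i = \<beta> powi j \<longleftrightarrow> [i = j] (mod int e)"
proof -
  have "\<beta> powi i = \<beta> powi j \<longleftrightarrow> \<beta> powi (i - j) = 1"
    using primitive_root_of_unity_neq_0[OF assms] by (simp add: power_int_diff)
  then show ?thesis using assms by (simp add: primitive_root_of_unity_def cong_iff_dvd_diff)
qed

lemma generates_units_neq_0: "generates_units \<gamma> \<Longrightarrow> \<gamma> \<noteq> 0"
  unfolding generates_units_def by (metis Diff_iff insertI1 power_int_1_right rangeI)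

lemma powi_mod_card_minus_1:
  fixes x :: "'a::{field,finite}"
  assumes "x \<noteq> 0"
  shows "x powi (i mod int (CARD('a) - 1)) = x powi i"
proof -
  let ?M = "int (CARD('a) - 1)"
  have "x powi (?M * (i div ?M)) = 1"
    unfolding power_int_mult power_int_of_nat power_card_minus_1_finite_field[OF assms] by simp
  moreover have "x powi (?M * (i div ?M)) * x powi (i mod ?M) = x powi i"
    unfolding power_int_add[OF disjI1[OF assms], symmetric] mult_div_mod_eq ..
  ultimately show ?thesis by simp
qed

lemma bij_betw_powi_generator:
  fixes \<gamma> :: "'a::{field,finite}"
  assumes "generates_units \<gamma>"
  shows "bij_betw (\<lambda>i. \<gamma> powi i) {0..<int (CARD('a) - 1)} (UNIV - {0})"
proof -
  let ?M = "int (CARD('a) - 1)"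
  have "?M > 0" using card_finite_field_gt_1[where 'a='a] by simp
  have "\<gamma> powi i \<in> (\<lambda>i. \<gamma> powi i) ` {0..<?M}" for i
    using \<open>?M > 0\<close> powi_mod_card_minus_1[OF generates_units_neq_0[OF assms], of i, symmetric]
    by (intro image_eqI[of _ _ "i mod ?M"]) auto
  then have "(\<lambda>i. \<gamma> powi i) ` {0..<?M} = range (\<lambda>i::int. \<gamma> powi i)" by blast
  then have "(\<lambda>i. \<gamma> powi i) ` {0..<?M} = UNIV - {0}"
    using assms by (simp add: generates_units_def)
  moreover have "card {0..<?M} = card (UNIV - {0::'a})" by (simp add: card_Diff_singleton)
  ultimately show ?thesis by (simp add: bij_betw_def eq_card_imp_inj_on)
qed

lemma primitive_root_of_unity_generator:
  fixes \<gamma> :: "'a::{field,finite}"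
  assumes "generates_units \<gamma>"
  shows "primitive_root_of_unity (CARD('a) - 1) \<gamma>"
  unfolding primitive_root_of_unity_def
proof (intro conjI allI)
  let ?M = "int (CARD('a) - 1)"
  show "CARD('a) - 1 > 0" using card_finite_field_gt_1[where 'a='a] by simp
  fix i
  have "\<gamma> powi i = 1 \<longleftrightarrow> \<gamma> powi (i mod ?M) = \<gamma> powi 0"
    by (simp only: powi_mod_card_minus_1[OF generates_units_neq_0[OF assms]] power_int_0_right)
  also have "\<dots> \<longleftrightarrow> i mod ?M = 0"
    by (rule inj_on_eq_iff[OF bij_betw_imp_inj_on[OF bij_betw_powi_generator[OF assms]]])
       (use \<open>CARD('a) - 1 > 0\<close> in auto)
  also have "\<dots> \<longleftrightarrow> ?M dvd i" by (simp only: dvd_eq_mod_eq_0)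
  finally show "\<gamma> powi i = 1 \<longleftrightarrow> ?M dvd i" .
qed

lemma primitive_root_of_unity_powi:
  assumes "primitive_root_of_unity (L * e) \<gamma>"
  shows "primitive_root_of_unity e (\<gamma> powi int L)"
  using assms unfolding primitive_root_of_unity_def power_int_mult[symmetric] by auto

definition root_transform :: "nat \<Rightarrow> 'a::field \<Rightarrow> (nat \<Rightarrow> int) \<Rightarrow> (nat \<Rightarrow> 'a) \<Rightarrow> int \<Rightarrow> 'a" where
  "root_transform t \<beta> \<Delta> x h = (\<Sum>j=1..t. x j * \<beta> powi (\<Delta> j * h))"

lemma root_transform_add:
  "root_transform t \<beta> \<Delta> (x + y) h
     = root_transform t \<beta> \<Delta> x h + root_transform t \<beta> \<Delta> y h"
  by (simp add: root_transform_def distrib_right sum.distrib)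

lemma root_transform_scale:
  "root_transform t \<beta> \<Delta> (\<lambda>j. c * x j) h = c * root_transform t \<beta> \<Delta> x h"
  by (simp add: root_transform_def sum_distrib_left mult.assoc)

lemma root_transform_restrict:
  "root_transform t \<beta> \<Delta> (restrict x {1..t}) h = root_transform t \<beta> \<Delta> x h"
  by (simp add: root_transform_def)

lemma root_transform_shift:
  assumes "\<beta> \<noteq> 0"
  shows "root_transform t \<beta> \<Delta> x (h + d) = root_transform t \<beta> \<Delta> (\<lambda>j. x j * \<beta> powi (\<Delta> j * d)) h"
  using assms by (simp add: root_transform_def distrib_left power_int_add mult_ac)

lemma periodic_root_transform:
  assumes "\<beta> \<noteq> 0" and root: "\<And>j. j \<in> {1..t} \<Longrightarrow> \<beta> powi (\<Delta> j * M) = 1"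
  shows "periodic M (root_transform t \<beta> \<Delta> x)"
  unfolding periodic_def
proof (intro allI impI)
  fix i k assume "[i = k] (mod M)"
  then obtain l where i: "i = k + M * l" by (metis cong_iff_lin cong_sym)
  have "\<beta> powi (\<Delta> j * (M * l)) = 1" if "j \<in> {1..t}" for j
    using root[OF that] by (simp add: power_int_mult flip: mult.assoc)
  then show "root_transform t \<beta> \<Delta> x i = root_transform t \<beta> \<Delta> x k"
    unfolding i root_transform_shift[OF assms(1)] by (simp add: root_transform_def)
qed

lemma sum_powi_root_of_unity:
  assumes "primitive_root_of_unity e \<beta>"
  shows "(\<Sum>h\<in>{0..<int e}. \<beta> powi (c * h)) = (if int e dvd c then of_nat e else 0)"
proof (cases "int e dvd c")
  case True
  then have "\<beta> powi (c * h) = 1" for h using assms by (simp add: primitive_root_of_unity_def)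
  then show ?thesis using True by simp
next
  case False
  let ?S = "\<Sum>h\<in>{0..<int e}. \<beta> powi (c * h)"
  have "periodic (int e) (\<lambda>h. \<beta> powi (c * h))"
    by (simp add: periodic_def powi_eq_iff_cong[OF assms] cong_scalar_left)
  then have "?S = (\<Sum>h\<in>{0..<int e}. \<beta> powi (c * (h + 1)))"
    using assms by (intro sum_periodic_shift[symmetric]) (simp_all add: primitive_root_of_unity_def)
  also have "\<dots> = \<beta> powi c * ?S"
    using primitive_root_of_unity_neq_0[OF assms]
    by (simp add: distrib_left power_int_add sum_distrib_left mult.commute)
  finally have "(\<beta> powi c - 1) * ?S = 0" by (simp add: left_diff_distrib)
  moreover have "\<beta> powi c \<noteq> 1" using False assms by (simp add: primitive_root_of_unity_def)
  ultimately show ?thesis using False by simp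
qed

lemma sum_twisted_root_transform:
  assumes "primitive_root_of_unity e \<beta>"
  shows "(\<Sum>h\<in>{0..<int e}. \<beta> powi (- (d * h)) * root_transform t \<beta> \<Delta> x h)
       = of_nat e * (\<Sum>j | j \<in> {1..t} \<and> [\<Delta> j = d] (mod int e). x j)"
proof -
  have twist: "\<beta> powi (- (d * h)) * \<beta> powi (\<Delta> j * h) = \<beta> powi ((\<Delta> j - d) * h)" for h j
    using primitive_root_of_unity_neq_0[OF assms]
    by (simp add: algebra_simps flip: power_int_add)
  have "\<beta> powi (- (d * h)) * root_transform t \<beta> \<Delta> x h
      = (\<Sum>j=1..t. x j * \<beta> powi ((\<Delta> j - d) * h))" for h
    unfolding root_transform_def sum_distrib_left twist[symmetric] by (simp add: mult_ac)
  then have "(\<Sum>h\<in>{0..<int e}. \<beta> powi (- (d * h)) * root_transform t \<beta> \<Delta> x h)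
      = (\<Sum>j=1..t. x j * (\<Sum>h\<in>{0..<int e}. \<beta> powi ((\<Delta> j - d) * h)))"
    by (simp add: sum_distrib_left) (rule sum.swap)
  also have "\<dots> = of_nat e * (\<Sum>j=1..t. if [\<Delta> j = d] (mod int e) then x j else 0)"
    unfolding sum_powi_root_of_unity[OF assms] sum_distrib_left
    by (intro sum.cong) (auto simp: cong_iff_dvd_diff)
  finally show ?thesis by (simp flip: sum.inter_filter)
qed

lemma root_transform_eq_imp_eq:
  assumes "primitive_root_of_unity e \<beta>" "of_nat e \<noteq> (0::'a::field)"
    and "inj_on (\<lambda>j. \<Delta> j mod int e) {1..t}"
    and eq: "\<forall>h\<in>{0..<int e}. root_transform t \<beta> \<Delta> x h = root_transform t \<beta> \<Delta> x' h"
    and i: "i \<in> {1..t}"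
  shows "x i = (x' i :: 'a)"
proof -
  have "{j. j \<in> {1..t} \<and> [\<Delta> j = \<Delta> i] (mod int e)} = {i}"
    using inj_on_eq_iff[OF assms(3) _ i] i unfolding cong_def by blast
  then have inversion:
    "(\<Sum>h\<in>{0..<int e}. \<beta> powi (- (\<Delta> i * h)) * root_transform t \<beta> \<Delta> y h)
     = of_nat e * y i" for y
    using sum_twisted_root_transform[OF assms(1)] by simp
  have "of_nat e * x i = of_nat e * x' i"
    unfolding inversion[symmetric] using eq by simp
  then show ?thesis using assms(2) by simp
qed

lemma ex_missed_residue:
  assumes "t < e"
  shows "\<exists>d. \<forall>j\<in>{1..t}. \<not> [\<Delta> j = d] (mod int e)"
proof -
  have "card ((\<lambda>j. \<Delta> j mod int e) ` {1..t}) < card {0..<int e}"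
    using card_image_le[of "{1..t}" "\<lambda>j. \<Delta> j mod int e"] assms by simp
  then have "\<not> {0..<int e} \<subseteq> (\<lambda>j. \<Delta> j mod int e) ` {1..t}"
    by (meson card_mono finite_atLeastAtMost finite_imageI not_le)
  then obtain d where "d \<in> {0..<int e}" "d \<notin> (\<lambda>j. \<Delta> j mod int e) ` {1..t}" by blast
  then show ?thesis by (intro exI[of _ d]) (auto simp: cong_def)
qed

lemma bij_betw_twisted_root_transform:
  fixes \<beta> :: "'a::{field,finite}"
  assumes "primitive_root_of_unity (t + 1) \<beta>" "of_nat (t + 1) \<noteq> (0::'a)"
    and "inj_on (\<lambda>j. \<Delta> j mod int (t + 1)) {1..t}"
    and missed: "\<forall>j\<in>{1..t}. \<not> [\<Delta> j = d] (mod int (t + 1))"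
  shows "bij_betw (\<lambda>x. \<lambda>h\<in>{0..<int (t + 1)}. \<beta> powi (- (d * h)) * root_transform t \<beta> \<Delta> x h)
           (tuples t) (zero_sums {0..<int (t + 1)})"
proof -
  let ?I = "{0..<int (t + 1)}" and ?Z = "zero_sums {0..<int (t + 1)} :: (int \<Rightarrow> 'a) set"
  define Z where "Z x = (\<lambda>h\<in>?I. \<beta> powi (- (d * h)) * root_transform t \<beta> \<Delta> x h)" for x
  have "inj_on Z (tuples t)"
  proof (rule inj_onI)
    fix x x' assume x: "x \<in> tuples t" "x' \<in> tuples t" and "Z x = Z x'"
    have "root_transform t \<beta> \<Delta> x h = root_transform t \<beta> \<Delta> x' h" if "h \<in> ?I" for h
      using fun_cong[OF \<open>Z x = Z x'\<close>, of h] that primitive_root_of_unity_neq_0[OF assms(1)]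
      by (simp add: Z_def)
    then have "x i = x' i" if "i \<in> {1..t}" for i
      using that by (intro root_transform_eq_imp_eq[OF assms(1-3)]) auto
    then show "x = x'" using x unfolding tuples_def by (intro PiE_ext) auto
  qed
  moreover have "Z ` tuples t = ?Z"
  proof (rule card_seteq)
    have none: "{j. j \<in> {1..t} \<and> [\<Delta> j = d] (mod int (t + 1))} = {}" using missed by blast
    have "sum (Z x) ?I = 0" for x
      using sum_twisted_root_transform[OF assms(1), of d t \<Delta> x] unfolding none by (simp add: Z_def)
    then show "Z ` tuples t \<subseteq> ?Z" by (auto simp: zero_sums_def Z_def)
    have "card (Z ` tuples t) = CARD('a) ^ t"
      unfolding card_image[OF \<open>inj_on Z (tuples t)\<close>] by (simp add: tuples_def card_PiE)
    then show "card ?Z \<le> card (Z ` tuples t)" by (simp add: card_zero_sums nat_add_distrib)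
  qed (simp add: zero_sums_def finite_PiE)
  ultimately have "bij_betw Z (tuples t) ?Z" by (simp add: bij_betw_def)
  then show ?thesis unfolding Z_def .
qed

section \<open>The trace of an extension of finite fields\<close>

lemma minus_1_dvd_power_minus_1:
  fixes a :: nat
  assumes "a > 0"
  shows "a - 1 dvd a ^ k - 1"
proof -
  have "[a = 1] (mod a - 1)" using assms by (intro cong_altdef_nat[THEN iffD2]) auto
  then have "[a ^ k = 1 ^ k] (mod a - 1)" by (rule cong_pow)
  then show ?thesis unfolding power_one by (rule cong_to_1_nat)
qed

locale finite_field_extension =
  fixes \<iota> :: "'q::{field,finite} \<Rightarrow> 'r::{field,finite}" and q r s m :: nat
  assumes embedding: "field_embedding \<iota>"
    and card_q: "CARD('q) = q" and card_r: "CARD('r) = r"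
    and r_eq: "r = q ^ m" and q_eq: "q = CHAR('r) ^ s"
begin

lemma q_gt_1: "q > 1" and r_gt_1: "r > 1"
  using card_finite_field_gt_1[where 'a='q] card_finite_field_gt_1[where 'a='r]
  by (simp_all only: card_q card_r)

lemma m_gt_0: "m > 0"
  using r_gt_1 by (auto simp: r_eq intro: gr0I)

lemma iota_1 [simp]: "\<iota> 1 = 1" and iota_add: "\<iota> (x + y) = \<iota> x + \<iota> y"
  and iota_mult: "\<iota> (x * y) = \<iota> x * \<iota> y"
  using embedding by (auto simp: field_embedding_def)

lemma iota_0 [simp]: "\<iota> 0 = 0"
  using iota_add[of 0 0] by (metis add.right_neutral add_left_cancel)

lemma iota_minus: "\<iota> (- x) = - \<iota> x"
  using iota_add[of x "- x"] by (simp add: eq_neg_iff_add_eq_0 add.commute)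

lemma iota_eq_0_iff [simp]: "\<iota> x = 0 \<longleftrightarrow> x = 0"
proof
  assume "\<iota> x = 0"
  then have "\<iota> (x * inverse x) = 0" by (simp only: iota_mult mult_zero_left)
  then show "x = 0" by (cases "x = 0") simp_all
qed simp

lemma inj_iota: "inj \<iota>"
proof (rule injI)
  fix x y assume "\<iota> x = \<iota> y"
  then have "\<iota> (x + - y) = 0" unfolding iota_add iota_minus by simp
  then show "x = y" by simp
qed

lemma iota_power: "\<iota> (x ^ k) = \<iota> x ^ k"
  by (induction k) (simp_all add: iota_mult)

lemma iota_power_q: "\<iota> c ^ q = \<iota> c"
  using power_card_finite_field[of c] by (simp add: card_q flip: iota_power)

lemma range_iota: "range \<iota> = {z. z ^ q = z}"
proof (rule card_seteq)
  show "range \<iota> \<subseteq> {z. z ^ q = z}" by (auto simp: iota_power_q)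
  have "z ^ q = z \<longleftrightarrow> z = 0 \<or> z ^ (q - 1) = 1" for z :: 'r
    using q_gt_1 power_minus_mult[of q z] by (cases "z = 0") auto
  then have "{z::'r. z ^ q = z} = insert 0 {z. z ^ (q - 1) = 1}" by blast
  then have "card {z::'r. z ^ q = z} \<le> Suc (card {z::'r. z ^ (q - 1) = 1})"
    by (simp add: card_insert_le_m1)
  also have "\<dots> \<le> Suc (q - 1)"
    using q_gt_1 by (intro Suc_le_mono[THEN iffD2] card_power_eq_1_le) simp
  also have "\<dots> = card (range \<iota>)" using q_gt_1 by (simp add: card_image[OF inj_iota] card_q)
  finally show "card {z::'r. z ^ q = z} \<le> card (range \<iota>)" .
qed simp

lemma frobenius_add: "(x + y :: 'r) ^ (q ^ i) = x ^ (q ^ i) + y ^ (q ^ i)"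
proof (rule freshmans_dream')
  show "prime CHAR('r)" by (rule prime_CHAR_semidom) (simp add: finite_imp_CHAR_pos)
  show "q ^ i = CHAR('r) ^ (s * i)" by (simp add: q_eq power_mult)
qed

lemma frobenius_sum: "(\<Sum>i\<in>I. f i :: 'r) ^ q = (\<Sum>i\<in>I. f i ^ q)"
proof (induction I rule: infinite_finite_induct)
  case (insert i I)
  then show ?case using frobenius_add[of "f i" "sum f I" 1] by simp
qed (use q_gt_1 in \<open>auto simp: power_0_left\<close>)

lemma iota_field_trace: "\<iota> (field_trace \<iota> m x) = (\<Sum>i<m. x ^ (q ^ i))"
proof -
  let ?T = "\<Sum>i<m. x ^ (q ^ i)"
  have "?T ^ q = (\<Sum>i<m. x ^ (q ^ Suc i))"
    by (simp add: frobenius_sum mult.commute flip: power_mult)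
  also have "\<dots> = (\<Sum>i<Suc m. x ^ (q ^ i)) - x"
    by (simp add: sum.lessThan_Suc_shift del: sum.lessThan_Suc)
  also have "\<dots> = ?T"
    using power_card_finite_field[of x] by (simp add: card_r r_eq)
  finally have "?T \<in> range \<iota>" by (simp add: range_iota)
  then obtain y where y: "?T = \<iota> y" by blast
  have "field_trace \<iota> m x = y"
    unfolding field_trace_def card_q y by (rule the_equality) (auto dest: injD[OF inj_iota])
  then show ?thesis using y by simp
qed

abbreviation tr :: "'r \<Rightarrow> 'q" where "tr \<equiv> field_trace \<iota> m"

lemma tr_add: "tr (x + y) = tr x + tr y"
  by (rule injD[OF inj_iota]) (simp add: iota_field_trace iota_add frobenius_add sum.distrib)

lemma tr_scale: "tr (\<iota> c * x) = c * tr x"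
proof (rule injD[OF inj_iota])
  have "\<iota> c ^ (q ^ i) = \<iota> c" for i
    by (induction i) (simp_all add: power_mult iota_power_q)
  then show "\<iota> (tr (\<iota> c * x)) = \<iota> (c * tr x)"
    by (simp add: iota_field_trace iota_mult power_mult_distrib sum_distrib_left)
qed

lemma tr_0 [simp]: "tr 0 = 0"
  using tr_scale[of 0 0] by simp

lemma tr_minus: "tr (- x) = - tr x"
  using tr_scale[of "- 1" x] by (simp add: iota_minus)

lemma tr_scale_eq_0_iff: "c \<noteq> 0 \<Longrightarrow> tr (\<iota> c * x) = 0 \<longleftrightarrow> tr x = 0"
  by (simp add: tr_scale)

text \<open>Otherwise all \<open>q ^ m\<close> elements would be roots of the trace polynomial, which has degree
  \<open>q ^ (m - 1)\<close>.\<close>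
lemma ex_tr_neq_0: "\<exists>x. tr x \<noteq> 0"
proof (rule ccontr)
  define P :: "'r poly" where "P = (\<Sum>i<m. Polynomial.monom 1 (q ^ i))"
  assume "\<not> (\<exists>x. tr x \<noteq> 0)"
  then have "(\<Sum>i<m. x ^ (q ^ i)) = 0" for x :: 'r by (simp flip: iota_field_trace)
  then have roots: "{x. poly P x = 0} = UNIV" by (simp add: P_def poly_sum poly_monom)
  have "q ^ i = q ^ 0 \<longleftrightarrow> i = 0" for i
    using q_gt_1 by (simp only: power_inject_exp)
  then have "poly.coeff P 1 = 1" using m_gt_0 by (simp add: P_def coeff_sum)
  then have "P \<noteq> 0" by auto
  then have "q ^ m \<le> degree P"
    using card_poly_roots_bound[of P] by (simp add: roots card_r r_eq)
  also have "\<dots> \<le> q ^ (m - 1)"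
    unfolding P_def
  proof (rule degree_sum_le)
    fix i assume "i \<in> {..<m}"
    then show "degree (Polynomial.monom (1::'r) (q ^ i)) \<le> q ^ (m - 1)"
      using q_gt_1 by (intro order.trans[OF degree_monom_le] power_increasing) auto
  qed simp
  also have "\<dots> < q ^ m" using q_gt_1 m_gt_0 by simp
  finally show False by simp
qed

lemma surj_tr: "surj tr"
proof -
  obtain x where "tr x \<noteq> 0" using ex_tr_neq_0 by blast
  then show ?thesis by (intro surjI[of tr "\<lambda>c. \<iota> (c / tr x) * x"]) (simp add: tr_scale)
qed

lemma card_tr_fibre: "card {x. tr x = c} = card {x. tr x = 0}"
proof -
  obtain y where "tr y = c" using surj_tr by (metis surjD)
  then have "bij_betw (\<lambda>x. x - y) {x. tr x = c} {x. tr x = 0}"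
    using tr_add[of _ y] tr_add[of _ "- y"]
    by (intro bij_betw_byWitness[where f' = "\<lambda>x. x + y"]) (auto simp: tr_minus)
  then show ?thesis by (rule bij_betw_same_card)
qed

lemma sum_over_tr_fibres:
  fixes f :: "'r \<Rightarrow> 'b::comm_monoid_add"
  shows "(\<Sum>c\<in>UNIV. \<Sum>x | tr x = c. f x) = (\<Sum>x\<in>UNIV. f x)"
  using sum.group[of UNIV UNIV tr f] by simp

lemma card_tr_kernel: "real (card {x. tr x = 0}) = real r / real q"
proof -
  have "r = (\<Sum>c\<in>UNIV. card {x. tr x = c})"
    using sum_over_tr_fibres[of "\<lambda>_. 1::nat"] by (simp add: card_r)
  also have "\<dots> = (\<Sum>c\<in>(UNIV :: 'q set). card {x. tr x = 0})"
    by (intro sum.cong refl card_tr_fibre)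
  also have "\<dots> = q * card {x. tr x = 0}" by (simp add: card_q)
  finally show ?thesis using q_gt_1 by simp
qed

lemma q_minus_1_dvd: "q - 1 dvd r - 1"
  using minus_1_dvd_power_minus_1[of q m] q_gt_1 by (simp add: r_eq)

lemma powi_in_range_iota:
  assumes "z \<noteq> 0" "int ((r - 1) div (q - 1)) dvd i"
  shows "z powi i \<in> range \<iota>"
proof -
  obtain c where i: "i = int ((r - 1) div (q - 1)) * c" using assms(2) by (rule dvdE)
  have "(z ^ ((r - 1) div (q - 1))) ^ (q - 1) = z ^ (r - 1)"
    using q_minus_1_dvd by (simp flip: power_mult)
  also have "\<dots> = 1" using power_card_minus_1_finite_field[OF assms(1)] by (simp only: card_r)
  finally have "(z ^ ((r - 1) div (q - 1))) ^ q = z ^ ((r - 1) div (q - 1))"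
    using q_gt_1 power_minus_mult[of q "z ^ ((r - 1) div (q - 1))"] by simp
  moreover have "(w powi c) ^ q = (w ^ q) powi c" for w :: 'r
    by (simp only: power_int_power power_int_power' mult.commute)
  ultimately have "(z powi i) ^ q = z powi i"
    by (simp only: i power_int_mult power_int_of_nat)
  then show ?thesis by (simp add: range_iota)
qed

text \<open>Powers of \<open>\<gamma>\<close> with exponents divisible by \<open>(r - 1) div (q - 1)\<close> lie in the small field, so
  multiplication by them preserves the kernel of the trace.\<close>
lemma sum_tr_powi_scale_gcd:
  assumes "\<gamma> \<noteq> 0"
  shows "(\<Sum>l\<in>{0..<int (r - 1)}. of_bool (tr (\<gamma> powi (b * l) * z) \<noteq> 0) :: real)
    = (\<Sum>l\<in>{0..<int (r - 1)}. of_bool (tr (\<gamma> powi (gcd b (int ((r - 1) div (q - 1))) * l) * z) \<noteq> 0))"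
proof -
  define k where "k = int ((r - 1) div (q - 1))"
  define F :: "int \<Rightarrow> real" where "F l = of_bool (tr (\<gamma> powi l * z) \<noteq> 0)" for l
  have r_minus_1: "int (r - 1) = k * int (q - 1)"
    using q_minus_1_dvd unfolding k_def by (metis dvd_div_mult_self of_nat_mult)
  moreover have "int (r - 1) > 0" using r_gt_1 by simp
  ultimately have "k > 0" by (simp only: zero_less_mult_iff) simp
  have "F i = F j" if "[i = j] (mod k)" for i j
  proof -
    have "\<gamma> powi (i - j) \<in> range \<iota>"
      using that unfolding k_def cong_iff_dvd_diff by (rule powi_in_range_iota[OF assms])
    then obtain c where c: "\<gamma> powi (i - j) = \<iota> c" by blast
    then have "c \<noteq> 0" using assms by auto
    moreover have "\<gamma> powi i = \<iota> c * \<gamma> powi j"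
      unfolding c[symmetric] power_int_add[OF disjI1[OF assms], symmetric] by simp
    ultimately show ?thesis by (simp add: F_def mult.assoc tr_scale_eq_0_iff)
  qed
  then have per: "periodic k F" by (simp add: periodic_def)
  then have per_mult: "periodic k (\<lambda>l. F (c * l))" for c
    by (simp add: periodic_def cong_scalar_left)
  have "(\<Sum>l\<in>{0..<k * int (q - 1)}. F (b * l)) = (\<Sum>l\<in>{0..<k * int (q - 1)}. F (gcd b k * l))"
    unfolding sum_periodic_multiple[OF \<open>k > 0\<close> per_mult]
      sum_periodic_scale_gcd[OF \<open>k > 0\<close> per, of b] ..
  then show ?thesis unfolding r_minus_1 F_def k_def .
qed

end

section \<open>Quadratic characters on the fibres of the trace\<close>

locale even_degree_extension = finite_field_extension \<iota> q r s m
  for \<iota> :: "'q::{field,finite} \<Rightarrow> 'r::{field,finite}" and q r s m :: nat +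
  assumes odd_q: "odd q" and even_m: "even m"
begin

lemma two_neq_0: "(2::'r) \<noteq> 0"
  using odd_q by (intro two_neq_0_finite_field) (simp add: card_r r_eq)

lemma quad_char_iota:
  assumes "c \<noteq> 0"
  shows "quad_char (\<iota> c) = 1"
proof -
  have "r = (q ^ 2) ^ (m div 2)" using even_m by (simp add: r_eq flip: power_mult)
  then have "q ^ 2 - 1 dvd r - 1" using minus_1_dvd_power_minus_1[of "q ^ 2"] q_gt_1 by simp
  moreover have "q ^ 2 - 1 = (q - 1) * (q + 1)" by (simp add: power2_eq_square algebra_simps)
  moreover have "(q - 1) * 2 dvd (q - 1) * (q + 1)" using odd_q by (intro mult_dvd_mono) auto
  ultimately obtain d where "r - 1 = (q - 1) * 2 * d" by (metis dvd_trans dvdE)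
  then have "(r - 1) div 2 = (q - 1) * d" by simp
  then have "\<iota> c ^ ((r - 1) div 2) = \<iota> ((c ^ (q - 1)) ^ d)" by (simp add: iota_power power_mult)
  also have "\<dots> = 1" using power_card_minus_1_finite_field[OF assms] by (simp add: card_q)
  finally show ?thesis
    using quad_char_eq_1_iff_power[of "\<iota> c"] odd_q by (simp add: card_r r_eq)
qed

lemma quad_char_minus_1: "quad_char (- 1 :: 'r) = 1"
  using quad_char_iota[of "- 1"] by (simp add: iota_minus)

lemma quad_char_minus: "quad_char (- x :: 'r) = quad_char x"
  using quad_char_mult[OF two_neq_0, of "- 1" x] by (simp add: quad_char_minus_1)

definition fibre_char_sum :: "'q \<Rightarrow> real" where
  "fibre_char_sum c = (\<Sum>x | tr x = c. quad_char x)"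

lemma fibre_char_sum_const:
  assumes "c \<noteq> 0"
  shows "fibre_char_sum c = fibre_char_sum 1"
proof -
  have "fibre_char_sum c = (\<Sum>x | tr x = 1. quad_char (\<iota> c * x))"
    unfolding fibre_char_sum_def
    by (rule sum.reindex_bij_witness[of _ "\<lambda>x. \<iota> c * x" "\<lambda>x. \<iota> (inverse c) * x"])
       (use assms in \<open>auto simp: tr_scale simp flip: mult.assoc iota_mult\<close>)
  also have "\<dots> = fibre_char_sum 1"
    by (simp add: fibre_char_sum_def quad_char_mult[OF two_neq_0] quad_char_iota[OF assms])
  finally show ?thesis .
qed

lemma fibre_char_sum_0: "fibre_char_sum 0 = - ((real q - 1) * fibre_char_sum 1)"
proof -
  have "(\<Sum>c\<in>UNIV. fibre_char_sum c) = 0"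
    unfolding fibre_char_sum_def sum_over_tr_fibres by (rule sum_quad_char[OF two_neq_0])
  then show ?thesis
    using sum_const_on_units[of fibre_char_sum, OF fibre_char_sum_const] by (simp add: card_q)
qed

text \<open>Both sides sum \<open>quad_char x * quad_char y\<close> over the pairs for which \<open>x + y\<close> lies in the kernel
  of the trace.\<close>
lemma sum_fibre_char_sum_squares: "(\<Sum>c\<in>UNIV. (fibre_char_sum c)\<^sup>2) = real r - real r / real q"
proof -
  have "(\<Sum>c\<in>UNIV. (fibre_char_sum c)\<^sup>2) = (\<Sum>c\<in>UNIV. \<Sum>x | tr x = c. quad_char x * fibre_char_sum c)"
    by (simp add: fibre_char_sum_def power2_eq_square sum_distrib_right)
  also have "\<dots> = (\<Sum>c\<in>UNIV. \<Sum>x | tr x = c. \<Sum>d | tr d = 0. quad_char x * quad_char (d - x))"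
  proof (intro sum.cong refl)
    fix c x assume "x \<in> {x. tr x = c}"
    then have "(\<Sum>d | tr d = 0. quad_char (d - x)) = (\<Sum>y | tr y = c. quad_char (- y))"
      using tr_add[of x "- _"]
      by (intro sum.reindex_bij_witness[of _ "\<lambda>y. x - y" "\<lambda>d. x - d"]) (auto simp: tr_minus)
    then show "quad_char x * fibre_char_sum c = (\<Sum>d | tr d = 0. quad_char x * quad_char (d - x))"
      by (simp only: fibre_char_sum_def quad_char_minus flip: sum_distrib_left)
  qed
  also have "\<dots> = (\<Sum>x\<in>UNIV. \<Sum>d | tr d = 0. quad_char x * quad_char (d - x))"
    by (rule sum_over_tr_fibres)
  also have "\<dots> = (\<Sum>d | tr d = 0. \<Sum>x\<in>UNIV. quad_char x * quad_char (d - x))"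
    by (rule sum.swap)
  also have "\<dots> = (\<Sum>d | tr d = 0. (if d = 0 then real r else 0) - 1)"
    by (simp only: sum_quad_char_convolution[OF two_neq_0] quad_char_minus_1 card_r mult_1)
  also have "\<dots> = real r - real r / real q"
    by (simp add: sum_subtractf card_tr_kernel)
  finally show ?thesis .
qed

definition gauss_sign :: real where
  "gauss_sign = real q * fibre_char_sum 1 / sqrt (real r)"

lemma gauss_sign_cases: "gauss_sign = 1 \<or> gauss_sign = -1"
proof -
  have "(\<Sum>c\<in>UNIV. (fibre_char_sum c)\<^sup>2)
      = (fibre_char_sum 0)\<^sup>2 + (real q - 1) * (fibre_char_sum 1)\<^sup>2"
    unfolding card_q[symmetric] by (rule sum_const_on_units) (metis fibre_char_sum_const)
  also have "\<dots> = (real q - 1) * (real q * (fibre_char_sum 1)\<^sup>2)"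
    by (simp add: fibre_char_sum_0 power2_eq_square algebra_simps)
  finally have "(real q - 1) * (real q * (fibre_char_sum 1)\<^sup>2) = (real q - 1) * (real r / real q)"
    using q_gt_1 by (simp add: sum_fibre_char_sum_squares field_simps)
  then have "real q * (fibre_char_sum 1)\<^sup>2 = real r / real q"
    using q_gt_1 by (simp only: mult_cancel_left) simp
  then have "gauss_sign\<^sup>2 = 1"
    using q_gt_1 r_gt_1 by (simp add: gauss_sign_def power_divide power_mult_distrib field_simps
        power2_eq_square)
  then show ?thesis by (simp add: power2_eq_1_iff)
qed

definition square_orbit_weight :: "'r \<Rightarrow> real" where
  "square_orbit_weight z = (\<Sum>y\<in>UNIV-{0}. of_bool (tr (y ^ 2 * z) \<noteq> 0))"

lemma square_orbit_weight_eq: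
  "square_orbit_weight z = (real q - 1) / real q * quad_weight gauss_sign z"
proof (cases "z = 0")
  case False
  let ?f = "\<lambda>s. of_bool (tr (s * z) \<noteq> 0) :: real"
  have kernel: "(\<Sum>s | tr (s * z) = 0. f s) = (\<Sum>x | tr x = 0. f (x / z))" for f :: "'r \<Rightarrow> real"
    by (rule sum.reindex_bij_witness[of _ "\<lambda>x. x / z" "\<lambda>s. s * z"]) (use False in auto)
  have "square_orbit_weight z = (\<Sum>s\<in>UNIV-{0}. (1 + quad_char s) * ?f s)"
    unfolding square_orbit_weight_def by (rule sum_over_squares[OF two_neq_0])
  also have "\<dots> = (\<Sum>s\<in>UNIV - {s. tr (s * z) = 0}. 1 + quad_char s)"
    by (rule sum.mono_neutral_cong_right) auto
  also have "\<dots> = (\<Sum>s\<in>(UNIV::'r set). 1 + quad_char s) - (\<Sum>s | tr (s * z) = 0. 1 + quad_char s)"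
    by (rule sum_diff) auto
  also have "(\<Sum>s\<in>(UNIV::'r set). 1 + quad_char s) = real r"
    by (simp add: sum.distrib sum_quad_char[OF two_neq_0] card_r)
  also have "(\<Sum>s | tr (s * z) = 0. 1 + quad_char s)
      = real r / real q + quad_char z * fibre_char_sum 0"
    unfolding kernel divide_inverse quad_char_mult[OF two_neq_0] quad_char_inverse
    by (simp add: sum.distrib card_tr_kernel fibre_char_sum_def sum_distrib_left mult.commute
        divide_inverse)
  also have "fibre_char_sum 0 = - ((real q - 1) / real q * gauss_sign * sqrt (real r))"
    using q_gt_1 r_gt_1 by (simp add: fibre_char_sum_0 gauss_sign_def)
  finally show ?thesis
    using False q_gt_1 by (simp add: quad_weight_def card_r field_simps)
qed (simp add: square_orbit_weight_def)

lemma sum_tr_square_orbit: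
  assumes "generates_units \<gamma>" "gcd b (int ((r - 1) div (q - 1))) = 2"
  shows "(\<Sum>l\<in>{0..<int (r - 1)}. of_bool (tr (\<gamma> powi (b * l) * z) \<noteq> 0)) = square_orbit_weight z"
proof -
  have "(\<Sum>l\<in>{0..<int (r - 1)}. of_bool (tr (\<gamma> powi (b * l) * z) \<noteq> 0) :: real)
      = (\<Sum>l\<in>{0..<int (r - 1)}. of_bool (tr ((\<gamma> powi l) ^ 2 * z) \<noteq> 0))"
    using sum_tr_powi_scale_gcd[OF generates_units_neq_0[OF assms(1)], of b z]
    by (simp only: assms(2) mult.commute[of 2] power_int_mult power_int_numeral)
  also have "\<dots> = square_orbit_weight z"
    using sum.reindex_bij_betw[OF bij_betw_powi_generator[OF assms(1)],
      of "\<lambda>y. of_bool (tr (y ^ 2 * z) \<noteq> 0)"]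
    by (simp only: square_orbit_weight_def card_r)
  finally show ?thesis .
qed

end

section \<open>Linear codes and trace codes\<close>

lemma (in vector_space) card_subspace:
  assumes "subspace C" "finite C"
  shows "card C = CARD('a) ^ dim C"
proof -
  obtain B where B: "B \<subseteq> C" "independent B" "C \<subseteq> span B" "card B = dim C"
    using basis_exists by blast
  have fin: "finite B" using B(1) assms(2) by (rule finite_subset)
  let ?g = "\<lambda>u. \<Sum>v\<in>B. scale (u v) v" and ?P = "PiE B (\<lambda>_. UNIV :: 'a set)"
  have "inj_on ?g ?P"
  proof (rule inj_onI)
    fix u u' assume u: "u \<in> ?P" "u' \<in> ?P" and "?g u = ?g u'"
    then have "(\<Sum>v\<in>B. scale (u v - u' v) v) = 0"
      by (simp add: scale_left_diff_distrib sum_subtractf)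
    then have "u v - u' v = 0" if "v \<in> B" for v
      using that by (rule independentD[OF B(2) fin order.refl])
    then show "u = u'" using u by (intro PiE_ext) auto
  qed
  moreover have "?g ` ?P = C"
  proof -
    have "C = range ?g"
      using B assms(1) by (simp add: subset_antisym span_minimal flip: span_finite[OF fin])
    moreover have "range ?g \<subseteq> ?g ` ?P"
    proof (rule image_subsetI)
      fix u
      have "?g u = ?g (restrict u B)" by (intro sum.cong) auto
      moreover have "restrict u B \<in> ?P" by simp
      ultimately show "?g u \<in> ?g ` ?P" by (rule image_eqI)
    qed
    ultimately show ?thesis by blast
  qed
  ultimately show ?thesis using fin B(4) card_image[of ?g ?P] by (simp add: card_PiE)
qed

lemma hamming_weight_0 [simp]: "hamming_weight n 0 = 0"
  by (simp add: hamming_weight_def)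

lemma hamming_weight_eq_sum: "real (hamming_weight n v) = (\<Sum>i<n. of_bool (v i \<noteq> 0))"
  by (simp add: hamming_weight_def sum_of_bool_eq Int_def)

lemma hamming_weight_eq_0_iff: "v \<in> words n \<Longrightarrow> hamming_weight n v = 0 \<longleftrightarrow> v = 0"
  unfolding hamming_weight_def words_def by (auto simp: fun_eq_iff) (metis not_le)

lemma min_distance_subspace:
  assumes "word_space.subspace C" "v \<in> C" "v \<noteq> 0"
    and least: "\<And>w. w \<in> C \<Longrightarrow> w \<noteq> 0 \<Longrightarrow> hamming_weight n v \<le> hamming_weight n w"
  shows "min_distance n C = hamming_weight n v"
  unfolding min_distance_def
proof (rule cInf_eq_minimum)
  have dist: "hamming_dist n x y = hamming_weight n (x - y)" for x y :: "nat \<Rightarrow> 'a"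
    by (simp add: hamming_dist_def hamming_weight_def)
  have "hamming_dist n v 0 = hamming_weight n v" by (simp add: dist)
  moreover have "0 \<in> C" using assms(1) by (rule word_space.subspace_0)
  ultimately show "hamming_weight n v \<in> {hamming_dist n v w |v w. v \<in> C \<and> w \<in> C \<and> v \<noteq> w}"
    using assms(2,3) by (metis (mono_tags, lifting) mem_Collect_eq)
  fix d assume "d \<in> {hamming_dist n v w |v w. v \<in> C \<and> w \<in> C \<and> v \<noteq> w}"
  then obtain x y where xy: "d = hamming_dist n x y" "x \<in> C" "y \<in> C" "x \<noteq> y" by blast
  then have "x - y \<in> C" "x - y \<noteq> 0" using word_space.subspace_diff[OF assms(1)] by auto
  then show "hamming_weight n v \<le> d" unfolding xy(1) dist by (rule least)
qed

context finite_field_extension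
begin

lemma codeword_eq:
  "codeword \<iota> m \<gamma> n t as x = (\<lambda>i. if i < n then tr (root_transform t \<gamma> as x (int i)) else 0)"
  by (simp add: fun_eq_iff codeword_def root_transform_def)

lemma codeword_in_words: "codeword \<iota> m \<gamma> n t as x \<in> words n"
  by (simp add: words_def codeword_def)

lemma codeword_add:
  "codeword \<iota> m \<gamma> n t as (x + y) = codeword \<iota> m \<gamma> n t as x + codeword \<iota> m \<gamma> n t as y"
  by (simp add: codeword_eq root_transform_add tr_add fun_eq_iff)

lemma codeword_scale:
  "codeword \<iota> m \<gamma> n t as (\<lambda>j. \<iota> c * x j) = scale_word c (codeword \<iota> m \<gamma> n t as x)"
  by (simp add: codeword_eq scale_word_def root_transform_scale tr_scale fun_eq_iff)

lemma codeword_0: "codeword \<iota> m \<gamma> n t as 0 = 0"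
  using codeword_add[of \<gamma> n t as 0 0] by simp

lemma codeword_diff:
  "codeword \<iota> m \<gamma> n t as (x - y) = codeword \<iota> m \<gamma> n t as x - codeword \<iota> m \<gamma> n t as y"
  using codeword_add[of \<gamma> n t as "x - y" y] by simp

lemma codeword_restrict: "codeword \<iota> m \<gamma> n t as (restrict x {1..t}) = codeword \<iota> m \<gamma> n t as x"
  unfolding codeword_eq root_transform_restrict ..

lemma trace_code_eq_range: "trace_code \<iota> m \<gamma> n t as = range (codeword \<iota> m \<gamma> n t as)"
proof -
  have "restrict x {1..t} \<in> tuples t" for x :: "nat \<Rightarrow> 'r" by (simp add: tuples_def)
  then have "codeword \<iota> m \<gamma> n t as x \<in> trace_code \<iota> m \<gamma> n t as" for x
    unfolding trace_code_def using codeword_restrict[symmetric] by (intro image_eqI)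
  then show ?thesis by (auto simp: trace_code_def)
qed

lemma subspace_trace_code: "word_space.subspace (trace_code \<iota> m \<gamma> n t as)"
  unfolding trace_code_eq_range
proof (rule word_space.subspaceI)
  show "0 \<in> range (codeword \<iota> m \<gamma> n t as)" by (metis codeword_0 rangeI)
qed (auto simp flip: codeword_add codeword_scale)

lemma cyclic_shift_codeword:
  assumes "\<gamma> \<noteq> 0" "n > 0" and root: "\<And>j. j \<in> {1..t} \<Longrightarrow> \<gamma> powi (as j * int n) = 1"
  shows "cyclic_shift n (codeword \<iota> m \<gamma> n t as x)
       = codeword \<iota> m \<gamma> n t as (\<lambda>j. x j * \<gamma> powi (as j * - 1))"
proof
  fix i
  let ?x = "\<lambda>j. x j * \<gamma> powi (as j * - 1)"
  have "root_transform t \<gamma> as x (int ((i + n - 1) mod n)) = root_transform t \<gamma> as x (int i + - 1)"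
  proof (rule periodicD[OF periodic_root_transform[OF assms(1) root]])
    have "[int (i + n - 1) = int i + - 1] (mod int n)"
      using assms(2) by (simp add: cong_iff_dvd_diff of_nat_diff)
    then show "[int ((i + n - 1) mod n) = int i + - 1] (mod int n)" by (simp add: zmod_int)
  qed
  also have "\<dots> = root_transform t \<gamma> as ?x (int i)" by (rule root_transform_shift[OF assms(1)])
  finally show "cyclic_shift n (codeword \<iota> m \<gamma> n t as x) i = codeword \<iota> m \<gamma> n t as ?x i"
    using assms(2) by (simp add: cyclic_shift_def codeword_eq)
qed

lemma cyclic_trace_code:
  assumes "\<gamma> \<noteq> 0" "n > 0" "\<And>j. j \<in> {1..t} \<Longrightarrow> \<gamma> powi (as j * int n) = 1"
    and inj: "inj_on (codeword \<iota> m \<gamma> n t as) (tuples t)"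
  shows "cyclic_code n (t * m) (trace_code \<iota> m \<gamma> n t as)"
proof -
  let ?C = "trace_code \<iota> m \<gamma> n t as"
  have "card ?C = r ^ t"
    unfolding trace_code_def
    by (simp add: card_image[OF inj]) (simp add: tuples_def card_PiE card_r)
  also have "\<dots> = q ^ (t * m)" by (simp only: r_eq power_mult[symmetric] mult.commute)
  finally have "q ^ word_space.dim ?C = q ^ (t * m)"
    using word_space.card_subspace[OF subspace_trace_code, of \<gamma> n t as]
    by (simp add: card_q trace_code_def tuples_def finite_PiE)
  then have "word_space.dim ?C = t * m" using q_gt_1 by (simp only: power_inject_exp)
  moreover have "?C \<subseteq> words n" using codeword_in_words by (auto simp: trace_code_def)
  moreover have "cyclic_shift n c \<in> ?C" if "c \<in> ?C" for c
    using that cyclic_shift_codeword[where as=as, OF assms(1-3)]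
    unfolding trace_code_eq_range by blast
  ultimately show ?thesis by (simp add: cyclic_code_def linear_code_def subspace_trace_code)
qed

end

section \<open>Weights and frequencies\<close>

lemma freq_reflect:
  assumes "u \<le> k + 1"
  shows "freq r t k (k + 1 - u) = freq r t k u"
proof -
  have "(k + 1) choose (k + 1 - u) = (k + 1) choose u"
    using assms by (rule binomial_symmetric[symmetric])
  moreover have "k + 1 - (k + 1 - u) = u" using assms by simp
  ultimately show ?thesis by (simp only: freq_def add.commute mult.commute)
qed

lemma freq_1_1: "freq r t 1 1 = 0"
proof -
  have "sqrt (real r) * sqrt (real r) = real r" by simp
  then show ?thesis by (simp add: freq_def algebra_simps)
qed

lemma freq_1_0_pos:
  assumes "r > 1" "t \<ge> 1"
  shows "freq r t 1 0 > 0"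
proof -
  have "0 < 2 * (real r - 1) + ((1 - sqrt (real r))\<^sup>2 + (1 + sqrt (real r))\<^sup>2)"
    using assms(1) by (intro add_pos_nonneg) auto
  also have "\<dots> = 2 * (real r - 1) ^ 1 - (- 1) ^ 1 *
      ((1 + sqrt (real r)) ^ 0 * (1 - sqrt (real r)) ^ (1 + 1 - 0)
      + (1 - sqrt (real r)) ^ 0 * (1 + sqrt (real r)) ^ (1 + 1 - 0))"
    by (simp add: power2_eq_square)
  finally show ?thesis
    unfolding freq_def using assms by (intro mult_pos_pos) (auto intro: zero_less_binomial)
qed

lemma weight1_1_0:
  "weight1 q r t \<delta> 1 0
     = 2 * (real q - 1) * (real r - sqrt (real r)) / ((real t + 1) * real q * real \<delta>)"
  by (simp add: weight1_def algebra_simps)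

lemma weight1_1_0_pos:
  assumes "q > 1" "r > 1" "\<delta> > 0"
  shows "weight1 q r t \<delta> 1 0 > 0"
  using assms sqrt_less_self[of "real r"] unfolding weight1_1_0 by simp

lemma weight1_ge:
  assumes "q > 1" "r > 1" "\<delta> > 0" "k \<ge> 1"
  shows "weight1 q r t \<delta> k u \<ge> weight1 q r t \<delta> 1 0"
    and "weight1 q r t \<delta> k u = weight1 q r t \<delta> 1 0 \<longleftrightarrow> k = 1 \<and> u = 0"
proof -
  let ?c = "(real q - 1) / ((real t + 1) * real q * real \<delta>)"
  let ?A = "(real k - 1) * (real r - sqrt (real r))" and ?B = "2 * real u * sqrt (real r)"
  have diff: "weight1 q r t \<delta> k u - weight1 q r t \<delta> 1 0 = ?c * (?A + ?B)"
    unfolding weight1_def right_diff_distrib[symmetric] by (simp add: algebra_simps)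
  have scale_pos: "?c > 0" using assms by simp
  have gap_pos: "real r - sqrt (real r) > 0" using assms sqrt_less_self[of "real r"] by simp
  have nonneg: "?A \<ge> 0" "?B \<ge> 0" using assms gap_pos by auto
  then have "?c * (?A + ?B) \<ge> 0" using scale_pos by (intro mult_nonneg_nonneg) auto
  then show "weight1 q r t \<delta> k u \<ge> weight1 q r t \<delta> 1 0" using diff by linarith
  have "weight1 q r t \<delta> k u = weight1 q r t \<delta> 1 0 \<longleftrightarrow> ?c * (?A + ?B) = 0"
    using diff by linarith
  also have "\<dots> \<longleftrightarrow> ?A + ?B = 0" using scale_pos by (simp only: mult_eq_0_iff) auto
  also have "\<dots> \<longleftrightarrow> ?A = 0 \<and> ?B = 0" using nonneg by linarith
  also have "\<dots> \<longleftrightarrow> k = 1 \<and> u = 0" using gap_pos assms by auto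
  finally show "weight1 q r t \<delta> k u = weight1 q r t \<delta> 1 0 \<longleftrightarrow> k = 1 \<and> u = 0" .
qed

text \<open>The sign in the weights for \<open>q mod 4 = 3\<close> only exchanges \<open>u\<close> and \<open>k + 1 - u\<close>, which have the
  same frequency.\<close>
lemma sum_freq_weight3:
  "(\<Sum>(k, u) | 1 \<le> k \<and> k \<le> t \<and> u \<le> k + 1 \<and> weight3 q m r t \<delta> k u = w. freq r t k u)
   = (\<Sum>(k, u) | 1 \<le> k \<and> k \<le> t \<and> u \<le> k + 1 \<and> weight1 q r t \<delta> k u = w. freq r t k u)"
proof (cases "even (m div 2)")
  case True
  then show ?thesis by (simp add: weight3_def weight1_def)
next
  case False
  have reflect: "weight1 q r t \<delta> k (k + 1 - u) = weight3 q m r t \<delta> k u"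
    "weight3 q m r t \<delta> k (k + 1 - u) = weight1 q r t \<delta> k u" if "u \<le> k + 1" for k u
  proof -
    have "real k + 1 - 2 * real (k + 1 - u) = - (real k + 1 - 2 * real u)"
      using that by (simp add: of_nat_diff)
    then show "weight1 q r t \<delta> k (k + 1 - u) = weight3 q m r t \<delta> k u"
      "weight3 q m r t \<delta> k (k + 1 - u) = weight1 q r t \<delta> k u"
      using False unfolding weight3_def weight1_def by simp_all
  qed
  show ?thesis
    by (rule sum.reindex_bij_witness[of _ "\<lambda>(k, u). (k, k + 1 - u)" "\<lambda>(k, u). (k, k + 1 - u)"])
       (use reflect freq_reflect in \<open>auto simp del: diff_Suc_eq_diff_pred\<close>)
qed

lemma card_weight_indices:
  "2 * card {(k, u). 1 \<le> k \<and> k \<le> t \<and> u \<le> k + (1::nat)} = t ^ 2 + 5 * t"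
proof -
  have "{(k, u). 1 \<le> k \<and> k \<le> t \<and> u \<le> k + 1} = (SIGMA k:{1..t}. {..k + 1})" by auto
  then have "card {(k, u). 1 \<le> k \<and> k \<le> t \<and> u \<le> k + 1} = (\<Sum>k=1..t. k + 2)" by simp
  moreover have "2 * (\<Sum>k=1..t. k + 2) = t ^ 2 + 5 * t"
    by (induction t) (simp_all add: power2_eq_square)
  ultimately show ?thesis by simp
qed

section \<open>Trace codes missing one frequency\<close>

lemma even_geometric_sum:
  fixes q m :: nat
  assumes "q > 1" "m > 0" "even ((q ^ m - 1) div (q - 1))"
  shows "odd q" "even m"
proof -
  have "int (q ^ m - 1) = int (q - 1) * int (\<Sum>i<m. q ^ i)"
    using assms(1) power_diff_1_eq[of "int q" m] by (simp add: of_nat_diff)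
  then have "q ^ m - 1 = (q - 1) * (\<Sum>i<m. q ^ i)"
    by (simp only: of_nat_mult[symmetric] of_nat_eq_iff)
  then have even: "even (\<Sum>i<m. q ^ i)" using assms by simp
  show "odd q"
  proof
    assume "even q"
    then have "odd (\<Sum>i<Suc k. q ^ i)" for k by (induction k) auto
    moreover have "m = Suc (m - 1)" using assms(2) by simp
    ultimately show False using even by metis
  qed
  then have "even (\<Sum>i<m. q ^ i) \<longleftrightarrow> even m" by (induction m) auto
  with even show "even m" by simp
qed

locale almost_full_trace_code = finite_field_extension \<iota> q r s m
  for \<iota> :: "'q::{field,finite} \<Rightarrow> 'r::{field,finite}" and q r s m :: nat +
  fixes \<gamma> :: 'r and e t \<delta> n :: nat and a :: int and \<Delta> as :: "nat \<Rightarrow> int"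
  assumes generator: "generates_units \<gamma>"
    and e_eq: "e = t + 1" and t_ge_1: "t \<ge> 1"
    and e_dvd: "e dvd q ^ (m div 2) - 1"
    and incongruent: "\<forall>i\<in>{1..t}. \<forall>j\<in>{1..t}. i \<noteq> j \<longrightarrow> \<not> [\<Delta> i = \<Delta> j] (mod int e)"
    and as_cong: "\<forall>i\<in>{1..t}. [as i = a + int ((r - 1) div e) * \<Delta> i] (mod int (r - 1))"
    and delta_eq: "int \<delta> = Gcd (insert (int (r - 1)) (as ` {1..t}))"
    and n_eq: "n = (r - 1) div \<delta>"
    and gcd_eq_2: "gcd (int ((r - 1) div (q - 1))) (a * int e) = 2"
    and even_a: "even a"
begin

sublocale even_degree_extension \<iota> q r s m
proof unfold_locales
  have "even (int ((r - 1) div (q - 1)))" using gcd_eq_2 by (metis gcd_dvd1)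
  then have "even ((q ^ m - 1) div (q - 1))" by (simp add: r_eq)
  then show "odd q" "even m" using even_geometric_sum[OF q_gt_1 m_gt_0] by blast+
qed

definition L :: nat where "L = (r - 1) div e"

abbreviation weight :: "(nat \<Rightarrow> 'r) \<Rightarrow> nat" where
  "weight x \<equiv> hamming_weight n (codeword \<iota> m \<gamma> n t as x)"

definition \<beta> :: 'r where "\<beta> = \<gamma> powi int L"

lemma gamma_neq_0: "\<gamma> \<noteq> 0"
  using generator by (rule generates_units_neq_0)

lemma primitive_root_gamma: "primitive_root_of_unity (r - 1) \<gamma>"
  using primitive_root_of_unity_generator[OF generator] by (simp only: card_r)

lemma e_pos: "e > 0"
  by (simp add: e_eq)

lemma r_minus_1_eq_L_e: "r - 1 = L * e" and even_L: "even L"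
proof -
  define Q where "Q = q ^ (m div 2)"
  have "r = q ^ (m div 2 * 2)" using even_m by (simp add: r_eq)
  then have "r = Q * Q" by (simp only: Q_def power_mult power2_eq_square)
  then have "r - 1 = (Q - 1) * (Q + 1)" by (simp add: algebra_simps)
  moreover obtain b where "Q - 1 = e * b" using e_dvd unfolding Q_def by (rule dvdE)
  ultimately have factors: "r - 1 = b * (Q + 1) * e" by (simp only: mult_ac)
  then have "L = b * (Q + 1)" using e_pos by (simp add: L_def)
  then show "r - 1 = L * e" using factors by (simp only:)
  have "odd Q" using odd_q by (simp add: Q_def)
  then show "even L" using \<open>L = _\<close> by simp
qed

lemma primitive_root_beta: "primitive_root_of_unity e \<beta>"
  unfolding \<beta>_def
  using primitive_root_gamma by (intro primitive_root_of_unity_powi) (simp only: r_minus_1_eq_L_e)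

lemma of_nat_e_neq_0: "of_nat e \<noteq> (0::'r)"
  by (intro of_nat_neq_0_finite_field) (simp only: card_r r_minus_1_eq_L_e dvd_triv_right)

lemma beta_powi: "\<beta> powi i = \<gamma> powi (int L * i)"
  by (simp only: \<beta>_def power_int_mult)

lemma periodic_root_transform_beta: "periodic (int e) (root_transform t \<beta> \<Delta> x)"
proof (rule periodic_root_transform)
  show "\<beta> \<noteq> 0" using primitive_root_beta by (rule primitive_root_of_unity_neq_0)
  show "\<beta> powi (\<Delta> j * int e) = 1" for j
    using primitive_root_beta by (simp add: primitive_root_of_unity_def)
qed

lemma inj_residues: "inj_on (\<lambda>j. \<Delta> j mod int e) {1..t}"
  using incongruent unfolding cong_def by (intro inj_onI) blast

lemma r_minus_1_eq_n_delta: "r - 1 = n * \<delta>" and n_pos: "n > 0" and delta_pos: "\<delta> > 0"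
proof -
  have "int \<delta> dvd int (r - 1)" unfolding delta_eq by (rule Gcd_dvd) simp
  then show product: "r - 1 = n * \<delta>" by (simp only: int_dvd_int_iff n_eq dvd_div_mult_self)
  show "n > 0" "\<delta> > 0" using product r_gt_1 by (auto intro: gr0I)
qed

lemma powi_as_n: "j \<in> {1..t} \<Longrightarrow> \<gamma> powi (as j * int n) = 1"
proof -
  assume "j \<in> {1..t}"
  then have "int \<delta> dvd as j" unfolding delta_eq by (intro Gcd_dvd) auto
  then have "int n * int \<delta> dvd as j * int n" by (simp add: mult.commute)
  then show ?thesis
    using primitive_root_gamma r_minus_1_eq_n_delta
    unfolding primitive_root_of_unity_def by (simp only: of_nat_mult)
qed

lemma root_transform_gamma_eq:
  "root_transform t \<gamma> as x i = \<gamma> powi (a * i) * root_transform t \<beta> \<Delta> x i"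
proof -
  have "\<gamma> powi (as j * i) = \<gamma> powi (a * i) * \<beta> powi (\<Delta> j * i)" if "j \<in> {1..t}" for j
  proof -
    have "[as j * i = (a + int L * \<Delta> j) * i] (mod int (r - 1))"
      using as_cong that unfolding L_def by (intro cong_scalar_right) blast
    then have "\<gamma> powi (as j * i) = \<gamma> powi ((a + int L * \<Delta> j) * i)"
      by (simp only: powi_eq_iff_cong[OF primitive_root_gamma])
    then show ?thesis
      using gamma_neq_0 by (simp add: beta_powi distrib_right power_int_add mult.assoc)
  qed
  then show ?thesis by (simp add: root_transform_def sum_distrib_left mult_ac)
qed

lemma sum_residue_class_weight:
  "real e * (\<Sum>l\<in>{0..<int L}. of_bool (tr (root_transform t \<gamma> as x (h + int e * l)) \<noteq> 0))
     = square_orbit_weight (root_transform t \<beta> \<Delta> x h)"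
proof -
  define z where "z = \<gamma> powi (a * h) * root_transform t \<beta> \<Delta> x h"
  let ?F = "\<lambda>l. of_bool (tr (\<gamma> powi (a * int e * l) * z) \<noteq> 0) :: real"
  have "root_transform t \<beta> \<Delta> x (h + int e * l) = root_transform t \<beta> \<Delta> x h" for l
    by (rule periodicD[OF periodic_root_transform_beta]) (simp add: cong_iff_dvd_diff)
  then have entry: "root_transform t \<gamma> as x (h + int e * l) = \<gamma> powi (a * int e * l) * z" for l
    using gamma_neq_0
    by (simp add: root_transform_gamma_eq z_def distrib_left power_int_add mult_ac)
  have "periodic (int L) ?F"
    unfolding periodic_def
  proof (intro allI impI)
    fix i j assume "[i = j] (mod int L)"
    then have "int L * int e dvd (i - j) * int e" by (simp add: cong_iff_dvd_diff)
    then have "int (r - 1) dvd a * ((i - j) * int e)"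
      unfolding r_minus_1_eq_L_e of_nat_mult by (rule dvd_mult)
    then have "[a * int e * i = a * int e * j] (mod int (r - 1))"
      by (simp add: cong_iff_dvd_diff algebra_simps)
    then show "?F i = ?F j" by (simp only: powi_eq_iff_cong[OF primitive_root_gamma, symmetric])
  qed
  then have "real e * (\<Sum>l\<in>{0..<int L}. ?F l) = (\<Sum>l\<in>{0..<int L * int e}. ?F l)"
    using r_minus_1_eq_L_e r_gt_1 by (intro sum_periodic_multiple[symmetric]) (auto intro: gr0I)
  also have "\<dots> = (\<Sum>l\<in>{0..<int (r - 1)}. ?F l)" by (simp only: r_minus_1_eq_L_e of_nat_mult)
  also have "\<dots> = square_orbit_weight z"
    by (rule sum_tr_square_orbit[OF generator]) (subst gcd.commute, rule gcd_eq_2)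
  also have "\<dots> = square_orbit_weight (root_transform t \<beta> \<Delta> x h)"
    using even_a gamma_neq_0 by (simp add: square_orbit_weight_eq z_def quad_weight_powi_even_mult)
  finally show ?thesis unfolding entry .
qed

lemma weight_eq_sum_quad_weight:
  "real (weight x) = (real q - 1) / (real e * real q * real \<delta>)
     * (\<Sum>h\<in>{0..<int e}. quad_weight gauss_sign (root_transform t \<beta> \<Delta> x h))"
proof -
  define S where "S = (\<Sum>h\<in>{0..<int e}. quad_weight gauss_sign (root_transform t \<beta> \<Delta> x h))"
  let ?F = "\<lambda>i. of_bool (tr (root_transform t \<gamma> as x i) \<noteq> 0) :: real"
  have "real (weight x) = (\<Sum>i<n. ?F (int i))"
    unfolding hamming_weight_eq_sum by (intro sum.cong) (auto simp: codeword_eq)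
  also have "\<dots> = (\<Sum>i\<in>{0..<int n}. ?F i)"
    by (rule sum.reindex_bij_witness[of _ nat int]) auto
  finally have "real \<delta> * real (weight x) = (\<Sum>i\<in>{0..<int n * int \<delta>}. ?F i)"
    using periodic_root_transform[of \<gamma> t as "int n" x] gamma_neq_0 powi_as_n n_pos
    by (subst sum_periodic_multiple) (auto simp: periodic_def)
  also have "int n * int \<delta> = int e * int L"
    using r_minus_1_eq_n_delta r_minus_1_eq_L_e by (simp only: of_nat_mult[symmetric] mult.commute)
  also have "(\<Sum>i\<in>{0..<int e * int L}. ?F i) = (\<Sum>h\<in>{0..<int e}. \<Sum>l\<in>{0..<int L}. ?F (h + int e * l))"
    using e_pos by (intro sum_int_residue_classes) simp
  finally have "real e * (real \<delta> * real (weight x))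
      = (\<Sum>h\<in>{0..<int e}. real e * (\<Sum>l\<in>{0..<int L}. ?F (h + int e * l)))"
    by (simp only: sum_distrib_left)
  also have "\<dots> = (\<Sum>h\<in>{0..<int e}. square_orbit_weight (root_transform t \<beta> \<Delta> x h))"
    by (simp only: sum_residue_class_weight)
  also have "\<dots> = (real q - 1) / real q * S"
    by (simp only: square_orbit_weight_eq S_def sum_distrib_left)
  finally show ?thesis
    using delta_pos q_gt_1 e_pos unfolding S_def[symmetric] by (simp add: field_simps)
qed

lemma weight_eq_0_iff: "weight x = 0 \<longleftrightarrow> (\<forall>i\<in>{1..t}. x i = 0)"
proof
  assume "weight x = 0"
  moreover have "(real q - 1) / (real e * real q * real \<delta>) \<noteq> 0"
    using q_gt_1 delta_pos e_pos by simp
  ultimately have "(\<Sum>h\<in>{0..<int e}. quad_weight gauss_sign (root_transform t \<beta> \<Delta> x h)) = 0"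
    using weight_eq_sum_quad_weight[of x] by (metis mult_eq_0_iff of_nat_0)
  then have "\<forall>h\<in>{0..<int e}. root_transform t \<beta> \<Delta> x h = 0"
    by (subst (asm) sum_quad_weight_eq_0_iff) (simp_all add: gauss_sign_cases)
  then have "\<forall>h\<in>{0..<int e}. root_transform t \<beta> \<Delta> x h = root_transform t \<beta> \<Delta> (\<lambda>_. 0) h"
    by (simp add: root_transform_def)
  then show "\<forall>i\<in>{1..t}. x i = 0"
    using root_transform_eq_imp_eq[OF primitive_root_beta of_nat_e_neq_0 inj_residues] by blast
next
  assume "\<forall>i\<in>{1..t}. x i = 0"
  then have "codeword \<iota> m \<gamma> n t as x = 0"
    by (simp add: codeword_eq root_transform_def fun_eq_iff)
  then show "weight x = 0" by simp
qed

lemma inj_on_codeword: "inj_on (codeword \<iota> m \<gamma> n t as) (tuples t)"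
proof (rule inj_onI)
  fix x y assume xy: "x \<in> tuples t" "y \<in> tuples t"
    and "codeword \<iota> m \<gamma> n t as x = codeword \<iota> m \<gamma> n t as y"
  then have "weight (x - y) = 0" by (simp add: codeword_diff)
  then have "x i = y i" if "i \<in> {1..t}" for i using that by (simp add: weight_eq_0_iff)
  then show "x = y" using xy unfolding tuples_def by (intro PiE_ext) auto
qed

lemma cyclic_code_trace_code: "cyclic_code n (t * m) (trace_code \<iota> m \<gamma> n t as)"
  using gamma_neq_0 n_pos powi_as_n inj_on_codeword by (rule cyclic_trace_code)

lemma card_weight_0: "card {x \<in> tuples t. weight x = 0} = 1"
proof -
  have "{x \<in> tuples t. weight x = 0} = PiE {1..t} (\<lambda>_. {0::'r})"
    unfolding tuples_def weight_eq_0_iff set_eq_iff mem_Collect_eq PiE_iff by blast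
  then show ?thesis by (simp add: card_PiE)
qed

theorem weight_distribution:
  assumes "w > 0"
  shows "real (card {x \<in> tuples t. real (weight x) = w})
    = (\<Sum>(k, u) | 1 \<le> k \<and> k \<le> t \<and> u \<le> k + 1 \<and> weight1 q r t \<delta> k u = w. freq r t k u)"
proof -
  let ?I = "{0..<int e}" and ?c = "(real q - 1) / (real e * real q * real \<delta>)"
  let ?wt = "\<lambda>z::int \<Rightarrow> 'r. ?c * (\<Sum>h\<in>?I. quad_weight gauss_sign (z h))"
  obtain d where "\<forall>j\<in>{1..t}. \<not> [\<Delta> j = d] (mod int e)"
    using ex_missed_residue[of t e \<Delta>] by (auto simp: e_eq)
  define Z where "Z x = (\<lambda>h\<in>?I. \<beta> powi (- (d * h)) * root_transform t \<beta> \<Delta> x h)" for x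
  have bij: "bij_betw Z (tuples t) (zero_sums ?I)"
    using bij_betw_twisted_root_transform[of t \<beta> \<Delta> d] primitive_root_beta
      of_nat_e_neq_0 inj_residues \<open>\<forall>j\<in>{1..t}. \<not> [\<Delta> j = d] (mod int e)\<close>
    unfolding e_eq Z_def by blast
  have "quad_weight gauss_sign (\<beta> powi i * z) = quad_weight gauss_sign z" for i z
    unfolding beta_powi
    using gamma_neq_0 even_L by (intro quad_weight_powi_even_mult) auto
  then have "real (weight x) = ?wt (Z x)" for x by (simp add: weight_eq_sum_quad_weight Z_def)
  then have "card {x \<in> tuples t. real (weight x) = w} = card {x \<in> tuples t. ?wt (Z x) = w}" by simp
  also have "\<dots> = card {z \<in> zero_sums ?I. ?wt z = w}"
    by (rule bij_betw_same_card[OF bij_betw_Collect[OF bij]]) simp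
  finally show ?thesis
    using weight_distribution_zero_sums[OF two_neq_0 quad_char_minus_1 _ _ gauss_sign_cases assms,
        of ?I t ?c]
    by (simp add: weight1_def card_r e_eq add.commute)
qed

lemma weight_occurs:
  assumes "weight x \<noteq> 0"
  obtains k u where "1 \<le> k" "k \<le> t" "u \<le> k + 1"
    "real (weight x) = weight1 q r t \<delta> k u" "freq r t k u \<noteq> 0"
proof -
  let ?x = "restrict x {1..t}"
  have "?x \<in> tuples t" by (simp add: tuples_def)
  then have "?x \<in> {y \<in> tuples t. real (weight y) = real (weight x)}"
    by (simp only: mem_Collect_eq codeword_restrict)
  moreover have "finite {y \<in> tuples t. real (weight y) = real (weight x)}"
    by (simp add: tuples_def finite_PiE)
  ultimately have "card {y \<in> tuples t. real (weight y) = real (weight x)} \<noteq> 0" by auto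
  then have "(\<Sum>(k, u) | 1 \<le> k \<and> k \<le> t \<and> u \<le> k + 1 \<and> weight1 q r t \<delta> k u = real (weight x).
      freq r t k u) \<noteq> 0"
    using weight_distribution[of "real (weight x)"] assms by simp
  then show ?thesis
    by (rule sum.not_neutral_contains_not_neutral) (use that in auto)
qed

lemma ex_weight_eq_weight1_1_0: "\<exists>x. real (weight x) = weight1 q r t \<delta> 1 0"
proof -
  let ?w = "weight1 q r t \<delta> 1 0"
  have "{(k, u). 1 \<le> k \<and> k \<le> t \<and> u \<le> k + 1 \<and> weight1 q r t \<delta> k u = ?w} = {(1, 0)}"
    using weight1_ge(2)[OF q_gt_1 r_gt_1 delta_pos] t_ge_1 by auto
  then have "real (card {x \<in> tuples t. real (weight x) = ?w}) = freq r t 1 0"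
    using weight_distribution[OF weight1_1_0_pos[OF q_gt_1 r_gt_1 delta_pos]] by simp
  then have "{x \<in> tuples t. real (weight x) = ?w} \<noteq> {}"
    using freq_1_0_pos[OF r_gt_1 t_ge_1] by (metis card.empty less_irrefl of_nat_0)
  then show ?thesis by blast
qed

lemma min_distance_eq: "real (min_distance n (trace_code \<iota> m \<gamma> n t as)) = weight1 q r t \<delta> 1 0"
proof -
  obtain x where x: "real (weight x) = weight1 q r t \<delta> 1 0" using ex_weight_eq_weight1_1_0 by blast
  have "min_distance n (trace_code \<iota> m \<gamma> n t as) = weight x"
  proof (rule min_distance_subspace[OF subspace_trace_code])
    show "codeword \<iota> m \<gamma> n t as x \<in> trace_code \<iota> m \<gamma> n t as" by (simp add: trace_code_eq_range)
    show "codeword \<iota> m \<gamma> n t as x \<noteq> 0"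
      using x weight1_1_0_pos[OF q_gt_1 r_gt_1 delta_pos, of t] by auto
    fix v assume "v \<in> trace_code \<iota> m \<gamma> n t as" "v \<noteq> 0"
    then obtain y where y: "v = codeword \<iota> m \<gamma> n t as y" by (auto simp: trace_code_eq_range)
    have "weight y \<noteq> 0"
      using \<open>v \<noteq> 0\<close> hamming_weight_eq_0_iff[OF codeword_in_words] unfolding y by blast
    then obtain k u where "1 \<le> k" "real (weight y) = weight1 q r t \<delta> k u" by (rule weight_occurs)
    then have "real (weight x) \<le> real (weight y)"
      using weight1_ge(1)[OF q_gt_1 r_gt_1 delta_pos] x by simp
    then show "weight x \<le> hamming_weight n v" by (simp add: y)
  qed
  then show ?thesis using x by simp
qed

text \<open>The index \<open>(1, 1)\<close> contributes no weight, because its frequency is \<open>0\<close>.\<close>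
lemma card_weights_le:
  "real (card (hamming_weight n ` trace_code \<iota> m \<gamma> n t as - {0}))
     \<le> ((real t)\<^sup>2 + 5 * real t - 2) / 2"
proof -
  let ?P = "{(k, u). 1 \<le> k \<and> k \<le> t \<and> u \<le> k + (1::nat)}"
  let ?W = "hamming_weight n ` trace_code \<iota> m \<gamma> n t as - {0}"
  have fin: "finite ?P" by (rule finite_subset[of _ "{..t} \<times> {..t+1}"]) auto
  have "real ` ?W \<subseteq> (\<lambda>(k, u). weight1 q r t \<delta> k u) ` (?P - {(1, 1)})"
  proof
    fix w assume "w \<in> real ` ?W"
    then obtain x where x: "w = real (weight x)" "weight x \<noteq> 0" by (auto simp: trace_code_eq_range)
    obtain k u where ku: "1 \<le> k" "k \<le> t" "u \<le> k + 1" "w = weight1 q r t \<delta> k u" "freq r t k u \<noteq> 0"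
      using weight_occurs[OF x(2)] unfolding x(1) by metis
    then have "(k, u) \<in> ?P - {(1, 1)}" using freq_1_1 by auto
    then show "w \<in> (\<lambda>(k, u). weight1 q r t \<delta> k u) ` (?P - {(1, 1)})"
      using ku(4) by (intro image_eqI[of _ _ "(k, u)"]) auto
  qed
  then have "card (real ` ?W) \<le> card (?P - {(1, 1)})"
    using fin by (meson card_image_le card_mono finite_Diff finite_imageI order.trans)
  moreover have "card (real ` ?W) = card ?W" by (rule card_image) simp
  moreover have "card (?P - {(1, 1)}) = card ?P - 1"
    using t_ge_1 by (subst card_Diff_singleton) auto
  moreover have "2 * card ?P = t ^ 2 + 5 * t" by (rule card_weight_indices)
  moreover have "card ?P > 0" using t_ge_1 fin by (auto simp: card_gt_0_iff)
  ultimately have "2 * card ?W + 2 \<le> t ^ 2 + 5 * t" by linarith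
  then have "real (2 * card ?W + 2) \<le> real (t ^ 2 + 5 * t)" by (simp only: of_nat_le_iff)
  then show ?thesis by simp
qed

end

theorem theorem1:
  fixes p s m q r e t \<delta> n :: nat
    and a :: int
    and \<Delta> as :: "nat \<Rightarrow> int"
    and \<iota> :: "'q::{field,finite} \<Rightarrow> 'r::{field,finite}"
    and \<gamma> :: 'r
  assumes "prime p" and "s \<ge> 1" and "m \<ge> 1" and "q = p ^ s" and "r = q ^ m"
    and "CARD('q) = q" and "CARD('r) = r" and "field_embedding \<iota>"
    and "generates_units \<gamma>"
    and "e \<ge> t" and "t \<ge> 2" and "e dvd r - 1"
    and "\<not> [a = 0] (mod int (r - 1))"
    and "\<forall>i\<in>{1..t}. \<forall>j\<in>{1..t}. i \<noteq> j \<longrightarrow> \<not> [\<Delta> i = \<Delta> j] (mod int e)"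
    and "Gcd (insert (int e) ((\<lambda>i. \<Delta> i - \<Delta> 1) ` {2..t})) = 1"
    and "\<forall>i\<in>{1..t}. [as i = a + int ((r - 1) div e) * \<Delta> i] (mod int (r - 1))"
    and "\<forall>i\<in>{1..t}. degree (minimal_poly \<iota> (\<gamma> powi (- as i))) = m"
    and "inj_on (\<lambda>i. minimal_poly \<iota> (\<gamma> powi (- as i))) {1..t}"
    and "int \<delta> = Gcd (insert (int (r - 1)) (as ` {1..t}))"
    and "n = (r - 1) div \<delta>"
    and "gcd (int ((r - 1) div (q - 1))) (a * int e) = 2"
    and "t = e - 1"
    and "e dvd q ^ (m div 2) - 1"
    and "2 dvd a"
  shows "cyclic_code n (t * m) (trace_code \<iota> m \<gamma> n t as)
    \<and> real (min_distance n (trace_code \<iota> m \<gamma> n t as))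
        = 2 * (real q - 1) * (real r - sqrt (real r)) / ((real t + 1) * real q * real \<delta>)
    \<and> real (card (hamming_weight n ` trace_code \<iota> m \<gamma> n t as - {0}))
        \<le> ((real t)\<^sup>2 + 5 * real t - 2) / 2
    \<and> card {x \<in> tuples t. hamming_weight n (codeword \<iota> m \<gamma> n t as x) = 0} = 1
    \<and> ([q = 1] (mod 4) \<longrightarrow>
        (\<forall>w::real. w > 0 \<longrightarrow>
          real (card {x \<in> tuples t. real (hamming_weight n (codeword \<iota> m \<gamma> n t as x)) = w})
          = (\<Sum>(k, u) | 1 \<le> k \<and> k \<le> t \<and> u \<le> k + 1 \<and> weight1 q r t \<delta> k u = w. freq r t k u)))
    \<and> ([q = 3] (mod 4) \<longrightarrow>
        (\<forall>w::real. w > 0 \<longrightarrow>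
          real (card {x \<in> tuples t. real (hamming_weight n (codeword \<iota> m \<gamma> n t as x)) = w})
          = (\<Sum>(k, u) | 1 \<le> k \<and> k \<le> t \<and> u \<le> k + 1 \<and> weight3 q m r t \<delta> k u = w. freq r t k u)))"
proof -
  have CHAR_r: "CHAR('r) = p"
    by (rule CHAR_finite_field_prime_power[OF assms(1), of "s * m"])
       (simp only: assms(4,5,7) power_mult)
  interpret almost_full_trace_code \<iota> q r s m \<gamma> e t \<delta> n a \<Delta> as
  proof unfold_locales
    show "q = CHAR('r) ^ s" using assms(4) by (simp only: CHAR_r)
    show "e = t + 1" "t \<ge> 1" using assms(11,22) by simp_all
  qed (rule assms)+
  show ?thesis
  proof (intro conjI impI allI)
    show "real (min_distance n (trace_code \<iota> m \<gamma> n t as))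
        = 2 * (real q - 1) * (real r - sqrt (real r)) / ((real t + 1) * real q * real \<delta>)"
      using min_distance_eq by (simp only: weight1_1_0)
  qed (simp_all only: cyclic_code_trace_code card_weights_le card_weight_0 weight_distribution
      sum_freq_weight3)
qed

end
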